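(* Let $\mu \in \mathbb{R}$, $\sigma > 0$, and let $(X_i)_{i \ge 1}$ be i.i.d. random variables following the Cauchy distribution $C(\mu,\sigma)$. Let $\alpha \in \mathbb{H}$ and, for $n \ge 1$, let \[ C_n^{(\alpha)} := \frac{\sum_{j=1}^{n} X_j/(X_j + \alpha)}{\sum_{j=1}^{n} 1/(X_j + \alpha)}. \] Then: (i) For $n \ge 3$, $C_n^{(\alpha)}$ is an unbiased estimator of $\mu+\sigma i$, i.e. $C_n^{(\alpha)}$ is integrable and $E[C_n^{(\alpha)}] = \mu + \sigma i$. (ii) $\lim_{n\to\infty} C_n^{(\alpha)} = \mu + \sigma i$ almost surely and in $L^p$ for every $0<p<+\infty$. (iii) \[ \lim_{n \to \infty} n\, \mathrm{Var}\left(C_n^{(\alpha)}\right) = \frac{\sigma}{\mathrm{Im}(\alpha)} \left|\mu + \sigma i + \alpha\right|^2. \]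
   Context: $\mathbb{H} = \{x+yi : x\in\mathbb{R},\, y>0\}$. $C(\mu,\sigma)$ is the distribution on $\mathbb{R}$ with density $\frac{\sigma}{\pi}\frac{1}{(x-\mu)^2+\sigma^2}$. For a complex-valued random variable $Y$, $E[Y] := E[\mathrm{Re}(Y)] + iE[\mathrm{Im}(Y)]$ and $\mathrm{Var}(Y) := E[|Y - E[Y]|^2]$. Convergence in $L^p$ means $E[|C_n^{(\alpha)} - (\mu+\sigma i)|^p] \to 0$ (the expectation being finite for all sufficiently large $n$). *)

theory Defs
  imports "HOL-Probability.Probability"
begin

definition upper_half_plane :: "complex set" where
  "upper_half_plane = {Complex x y | x y. y > 0}"

definition cauchy_density :: "real \<Rightarrow> real \<Rightarrow> real \<Rightarrow> real" where
  "cauchy_density \<mu> \<sigma> x = \<sigma> / pi * (1 / ((x - \<mu>)\<^sup>2 + \<sigma>\<^sup>2))"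

(* The sample is indexed from 1.  Neither division is degenerate when Im \<alpha> > 0: then
   X j \<omega> + \<alpha> is nonzero, and each 1 / (X j \<omega> + \<alpha>) has negative imaginary part, so the
   denominator is nonzero for n \<ge> 1. *)
definition cauchy_estimator ::
    "complex \<Rightarrow> (nat \<Rightarrow> 'a \<Rightarrow> real) \<Rightarrow> nat \<Rightarrow> 'a \<Rightarrow> complex" where
  "cauchy_estimator \<alpha> X n \<omega> =
     (\<Sum>j=1..n. complex_of_real (X j \<omega>) / (complex_of_real (X j \<omega>) + \<alpha>)) /
     (\<Sum>j=1..n. 1 / (complex_of_real (X j \<omega>) + \<alpha>))"

(* The expectation of a complex random variable is its Bochner integral, which for an
   integrable Y is the componentwise expectation E[Re Y] + i E[Im Y]. *)
lemma complex_expectation_componentwise: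
  fixes Y :: "'a \<Rightarrow> complex"
  assumes "integrable M Y"
  shows "integral\<^sup>L M Y =
    complex_of_real (LINT \<omega>|M. Re (Y \<omega>)) + \<i> * complex_of_real (LINT \<omega>|M. Im (Y \<omega>))"
  using assms by (simp add: complex_eq_iff)

(* prob_space.variance uses the square of Y - E[Y], which for complex Y is not the squared
   modulus.  The value is only meaningful where the integrand is integrable, since the
   Bochner integral of a non-integrable function is 0. *)
definition complex_variance :: "'a measure \<Rightarrow> ('a \<Rightarrow> complex) \<Rightarrow> real" where
  "complex_variance M Y = (LINT \<omega>|M. (cmod (Y \<omega> - integral\<^sup>L M Y))\<^sup>2)"

definition finite_complex_variance :: "'a measure \<Rightarrow> ('a \<Rightarrow> complex) \<Rightarrow> bool" where
  "finite_complex_variance M Y \<longleftrightarrow>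
     integrable M Y \<and> integrable M (\<lambda>\<omega>. (cmod (Y \<omega> - integral\<^sup>L M Y))\<^sup>2)"

(* Convergence in L^p to a constant; p < 1 is allowed. *)
definition converges_in_Lp ::
    "'a measure \<Rightarrow> real \<Rightarrow> (nat \<Rightarrow> 'a \<Rightarrow> complex) \<Rightarrow> complex \<Rightarrow> bool" where
  "converges_in_Lp M p Y c \<longleftrightarrow>
     (\<forall>\<^sub>F n in sequentially. integrable M (\<lambda>\<omega>. cmod (Y n \<omega> - c) powr p)) \<and>
     (\<lambda>n. LINT \<omega>|M. cmod (Y n \<omega> - c) powr p) \<longlonglongrightarrow> 0"

end

theory Submission
  imports Defs
begin

text \<open>With \<open>Y j = 1 / (X j + \<alpha>)\<close> and \<open>avg n\<close> the mean of \<open>Y 1, \<dots>, Y n\<close>, the estimator is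
  \<open>1 / avg n - \<alpha>\<close>, while \<open>\<gamma> = \<mu> + \<sigma> i\<close> equals \<open>\<beta> - \<alpha>\<close> for
  \<open>\<beta> = \<gamma> + \<alpha>\<close>. A bounded rational function that is holomorphic on the upper
  half-plane has mean equal to its value at \<open>\<gamma>\<close>, so \<open>Y j\<close> has mean \<open>m = 1 / \<beta>\<close>; applied to one variable at a time, this also gives mean \<open>\<beta>\<close> for \<open>1 / avg n\<close>.
  Integrability comes from the AM-GM inequality, which bounds \<open>1 / avg n\<close> up to a constant by
  the geometric mean of the independent \<open>(norm (X j + \<alpha>))\<^sup>2\<close>. Their moments of order below
  \<open>1/2\<close> are finite; hence the restriction \<open>n \<ge> 3\<close>, and moments of every order that stay
  bounded as \<open>n\<close> grows. The fourth moment of \<open>avg n - m\<close> is of order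
  \<open>1 / n\<^sup>2\<close>, which yields almost sure convergence, and together with the moment bounds it yields
  convergence in \<open>L\<^sup>p\<close> and the limit of the variance through the identity
  \<open>1 / avg n - \<beta> = - \<beta> (avg n - m) / avg n\<close>.\<close>

section \<open>The mean of a simple pole under the Cauchy distribution\<close>

text \<open>The explicit antiderivative settles the half-line x \<ge> 0. Since the integrand is
  even, the half-line part \<open>h\<close> and its reflection together dominate it.\<close>

lemma integrable_one_plus_abs_powr:
  fixes s :: real
  assumes "s > 1"
  shows "integrable lborel (\<lambda>x::real. (1 + \<bar>x\<bar>) powr - s)"
proof -
  define h where "h = (\<lambda>x::real. indicator {0..} x *\<^sub>R (1 + \<bar>x\<bar>) powr - s)"
  have "(\<integral>\<^sup>+x. ennreal ((1 + \<bar>x\<bar>) powr - s) * indicator {0..} x \<partial>lborel)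
      = ennreal (0 - (1 + 0) powr (1 - s) / (1 - s))"
  proof (rule nn_integral_FTC_atLeast)
    show "((\<lambda>x. (1 + x) powr (1 - s) / (1 - s)) has_real_derivative (1 + \<bar>x\<bar>) powr - s) (at x)"
      if "0 \<le> x" for x :: real
    proof -
      have "((\<lambda>x. (1 + x) powr (1 - s)) has_real_derivative
          (1 - s) * (1 + x) powr (1 - s - real 1) * (0 + 1)) (at x)"
        using that by (intro DERIV_fun_powr derivative_intros) auto
      from DERIV_cdivide[OF this, of "1 - s"] show ?thesis
        using that assms by simp
    qed
    have "((\<lambda>x. (1 + x) powr (1 - s)) \<longlongrightarrow> 0) at_top"
      using assms
      by (intro tendsto_neg_powr filterlim_tendsto_add_at_top[OF tendsto_const] filterlim_ident) auto
    then show "((\<lambda>x. (1 + x) powr (1 - s) / (1 - s)) \<longlongrightarrow> 0) at_top"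
      by (rule tendsto_divide_zero)
  qed auto
  then have "(\<integral>\<^sup>+x. ennreal (h x) \<partial>lborel) < \<infinity>"
    by (simp add: h_def ennreal_mult' ennreal_indicator mult.commute)
  then have h: "integrable lborel h"
    by (intro integrableI_nonneg) (auto simp: h_def)
  have h': "integrable lborel (\<lambda>x. h (- x))"
    using lborel_integrable_real_affine[OF h, of "-1" 0] by simp
  show ?thesis
    by (rule Bochner_Integration.integrable_bound[OF Bochner_Integration.integrable_add[OF h h']])
       (auto simp: h_def indicator_def)
qed

text \<open>A non-real c has distance at least \<bar>Im c\<bar> from every real point, and for large
  x that distance grows like \<bar>x\<bar>. Hence every factor with a non-real pole can be compared
  with 1 + \<bar>x\<bar>.\<close>

lemma one_plus_abs_le_norm_diff:
  assumes "Im c \<noteq> 0"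
  shows "1 + \<bar>x\<bar> \<le> (1 + (1 + norm c) / \<bar>Im c\<bar>) * norm (complex_of_real x - c)"
proof -
  have "\<bar>x\<bar> \<le> norm (complex_of_real x - c) + norm c"
    using norm_triangle_ineq[of "complex_of_real x - c" c] by simp
  moreover have "1 + norm c \<le> (1 + norm c) / \<bar>Im c\<bar> * norm (complex_of_real x - c)"
    using assms mult_left_mono[OF abs_Im_le_cmod[of "complex_of_real x - c"], of "1 + norm c"]
    by (simp add: divide_simps)
  ultimately show ?thesis
    by (simp add: algebra_simps)
qed

lemma of_real_neq_nonreal:
  assumes "Im c \<noteq> 0"
  shows "complex_of_real x - c \<noteq> 0"
  using assms by (auto simp: complex_eq_iff)

lemma of_real_plus_neq_0:
  assumes "Im c \<noteq> 0"
  shows "complex_of_real x + c \<noteq> 0"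
  using assms by (auto simp: complex_eq_iff)

text \<open>On a horizontal line Im z is constant, so inversion sends it to a circle through 0, on
  which the squared modulus is proportional to the imaginary part. The lower bound for
  \<open>avg\<close> and the variance of \<open>Y j\<close> both rest on this.\<close>

lemma Im_inverse_eq: "Im (1 / z) = - Im z * (norm (1 / z))\<^sup>2"
  by (simp add: norm_divide power_divide cmod_power2 Im_divide)

lemma norm_inverse_shift_le:
  assumes "Im \<delta> > 0"
  shows "norm (1 / (complex_of_real x + \<delta>)) \<le> 1 / Im \<delta>"
  using abs_Im_le_cmod[of "complex_of_real x + \<delta>"] assms
  by (simp add: norm_divide frac_le)

text \<open>Convexity of exp between 0 and ln t, that is, weighted AM-GM for 1 and t.\<close>

lemma powr_le_affine:
  fixes t q :: real
  assumes "t > 0" "0 \<le> q" "q \<le> 1"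
  shows "t powr q \<le> 1 + q * (t - 1)"
  using convex_onD[OF exp_convex, of q 0 "ln t"] assms
  by (simp add: powr_def algebra_simps)

text \<open>Comparison with twice the maximum treats exponents below and above 1 alike.\<close>

lemma powr_add_le:
  fixes x y q :: real
  assumes "0 \<le> x" "0 \<le> y" "0 \<le> q"
  shows "(x + y) powr q \<le> 2 powr q * (x powr q + y powr q)"
proof -
  have "(x + y) powr q \<le> (2 * max x y) powr q"
    using assms by (intro powr_mono2) auto
  also have "\<dots> = 2 powr q * max x y powr q"
    by (rule powr_mult)
  also have "max x y powr q \<le> x powr q + y powr q"
    by (simp add: max_def)
  finally show ?thesis by simp
qed

text \<open>The numerator grows with order s and the denominator with order 2, so the quotient
  decays with order 2 - s, which exceeds 1 exactly because s < 1.\<close>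

lemma integrable_powr_inverse_quadratic:
  assumes c: "Im c \<noteq> 0" and d: "Im d \<noteq> 0" and s: "0 \<le> s" "s < 1"
  shows "integrable lborel (\<lambda>x. norm (complex_of_real x + a) powr s /
    (norm (complex_of_real x - c) * norm (complex_of_real x - d)))"
proof -
  define K where "K b = 1 + (1 + norm b) / \<bar>Im b\<bar>" for b
  let ?f = "\<lambda>x. norm (complex_of_real x + a) powr s /
    (norm (complex_of_real x - c) * norm (complex_of_real x - d))"
  have "integrable lborel (\<lambda>x. K c * K d * (1 + norm a) powr s * (1 + \<bar>x\<bar>) powr - (2 - s))"
    using integrable_one_plus_abs_powr[of "2 - s"] s by simp
  then show ?thesis
  proof (rule Bochner_Integration.integrable_bound)
    show "AE x in lborel. norm (?f x)
        \<le> norm (K c * K d * (1 + norm a) powr s * (1 + \<bar>x\<bar>) powr - (2 - s))"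
    proof (intro AE_I2)
      fix x :: real
      have pos: "0 < norm (complex_of_real x - c)" "0 < norm (complex_of_real x - d)"
        using of_real_neq_nonreal[OF c] of_real_neq_nonreal[OF d] by simp_all
      have "norm (complex_of_real x + a) \<le> \<bar>x\<bar> + norm a"
        using norm_triangle_ineq[of "complex_of_real x" a] by simp
      also have "\<dots> \<le> (1 + norm a) * (1 + \<bar>x\<bar>)"
        by (simp add: algebra_simps)
      finally have "norm (complex_of_real x + a) powr s \<le> ((1 + norm a) * (1 + \<bar>x\<bar>)) powr s"
        using s by (intro powr_mono2) auto
      also have "\<dots> = (1 + norm a) powr s * (1 + \<bar>x\<bar>) powr s"
        by (rule powr_mult)
      finally have num: "norm (complex_of_real x + a) powr s
          \<le> (1 + norm a) powr s * (1 + \<bar>x\<bar>) powr s" .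
      have "(1 + \<bar>x\<bar>) * (1 + \<bar>x\<bar>)
          \<le> (K c * norm (complex_of_real x - c)) * (K d * norm (complex_of_real x - d))"
        unfolding K_def by
          (intro mult_mono one_plus_abs_le_norm_diff c d)
            (auto intro!: mult_nonneg_nonneg add_nonneg_nonneg)
      then have "1 / (norm (complex_of_real x - c) * norm (complex_of_real x - d))
          \<le> K c * K d / ((1 + \<bar>x\<bar>) * (1 + \<bar>x\<bar>))"
        using pos by (simp add: divide_simps mult_ac)
      from mult_mono[OF num this]
      have "?f x \<le> (1 + norm a) powr s * (1 + \<bar>x\<bar>) powr s * (K c * K d / ((1 + \<bar>x\<bar>) * (1 + \<bar>x\<bar>)))"
        by simp
      also have "\<dots> = K c * K d * (1 + norm a) powr s * (1 + \<bar>x\<bar>) powr - (2 - s)"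
        by (simp add: powr_diff power2_eq_square)
      finally show "norm (?f x) \<le> norm (K c * K d * (1 + norm a) powr s * (1 + \<bar>x\<bar>) powr - (2 - s))"
        by simp
    qed
  qed simp
qed

lemma integrable_inverse_quadratic:
  assumes c: "Im c \<noteq> 0" and d: "Im d \<noteq> 0"
  shows "integrable lborel (\<lambda>x. 1 / ((complex_of_real x - c) * (complex_of_real x - d)))"
proof (rule Bochner_Integration.integrable_bound)
  show "integrable lborel (\<lambda>x. norm (complex_of_real x + 0) powr 0 /
    (norm (complex_of_real x - c) * norm (complex_of_real x - d)))"
    using assms by (intro integrable_powr_inverse_quadratic) auto
  \<comment> \<open>As \<open>0 powr 0 = 0\<close>, the comparison function vanishes at x = 0; the
    bound holds only away from this point.\<close>
  have "AE x in lborel. x \<noteq> (0::real)"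
    by (rule AE_lborel_singleton)
  then show "AE x in lborel. norm (1 / ((complex_of_real x - c) * (complex_of_real x - d)))
    \<le> norm (norm (complex_of_real x + 0) powr 0 /
    (norm (complex_of_real x - c) * norm (complex_of_real x - d)))"
    by eventually_elim (simp add: norm_divide norm_mult)
qed measurable

section \<open>Products of two simple poles integrated over the real line\<close>

lemma integral_real_line_FTC:
  fixes f F :: "real \<Rightarrow> complex"
  assumes "\<And>x. (F has_vector_derivative f x) (at x)" "continuous_on UNIV f"
    and "integrable lborel f" "(F \<longlongrightarrow> A) at_bot" "(F \<longlongrightarrow> B) at_top"
  shows "integral\<^sup>L lborel f = B - A"
proof -
  have "(LBINT x=-\<infinity>..\<infinity>. f x) = B - A"
    using assms
    by (intro interval_integral_FTC_integrable[where F = F])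
       (auto simp: ereal_tendsto_simps set_integrable_def einterval_def continuous_on_eq_continuous_within)
  then show ?thesis
    by (simp add: interval_lebesgue_integral_def set_lebesgue_integral_def einterval_def)
qed

text \<open>For x > 0 the difference is Ln (1 - c / x), and Ln is continuous at 1. The subtracted
  real logarithm does not depend on c, so it cancels between two poles.\<close>

lemma tendsto_Ln_diff_ln_at_top:
  assumes "Im c \<noteq> 0"
  shows "((\<lambda>x. Ln (complex_of_real x - c) - complex_of_real (ln x)) \<longlongrightarrow> 0) at_top"
proof -
  have "((\<lambda>x. complex_of_real (inverse x)) \<longlongrightarrow> complex_of_real 0) at_top"
    by (rule tendsto_of_real[OF tendsto_inverse_0_at_top[OF filterlim_ident]])
  then have "((\<lambda>x. 1 - c * complex_of_real (inverse x)) \<longlongrightarrow> 1 - c * complex_of_real 0) at_top"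
    by (intro tendsto_diff tendsto_mult tendsto_const)
  then have "((\<lambda>x. Ln (1 - c * complex_of_real (inverse x))) \<longlongrightarrow> Ln 1) at_top"
    by (intro tendsto_Ln) auto
  moreover have "\<forall>\<^sub>F x in at_top. Ln (1 - c * complex_of_real (inverse x))
      = Ln (complex_of_real x - c) - complex_of_real (ln x)"
    using eventually_gt_at_top[of 0]
  proof eventually_elim
    case (elim x)
    have "1 - c * complex_of_real (inverse x) = (complex_of_real x - c) / complex_of_real x"
      using elim by (simp add: field_simps)
    then show ?case
      using elim of_real_neq_nonreal[OF assms, of x] by (simp only: Ln_divide_of_real[OF elim] not_False_eq_True)
  qed
  ultimately show ?thesis
    by (simp add: tendsto_cong)
qed

text \<open>Reflection reduces this to the limit at +\<infinity>. The extra term arises because x -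
  c approaches the branch cut of Ln from below if Im c > 0 and from above if Im c < 0.\<close>

lemma tendsto_Ln_diff_ln_at_bot:
  assumes "Im c \<noteq> 0"
  shows "((\<lambda>x. Ln (complex_of_real x - c) - complex_of_real (ln (- x)))
    \<longlongrightarrow> - (\<i> * of_real (sgn (Im c) * pi))) at_bot"
proof -
  have "((\<lambda>x. Ln (complex_of_real x - (- c)) - complex_of_real (ln x)
      - \<i> * of_real (sgn (Im c) * pi)) \<longlongrightarrow> 0 - \<i> * of_real (sgn (Im c) * pi)) at_top"
    using assms by (intro tendsto_intros tendsto_Ln_diff_ln_at_top) auto
  moreover have "Ln (complex_of_real x - (- c)) - \<i> * of_real (sgn (Im c) * pi)
      = Ln (complex_of_real (- x) - c)" for x
  proof -
    have "Ln (- (complex_of_real x + c)) = Ln (complex_of_real x + c) - \<i> * of_real (sgn (Im c) * pi)"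
      using assms of_real_plus_neq_0[OF assms, of x] by (subst Ln_minus) (auto simp: sgn_if)
    moreover have "complex_of_real (- x) - c = - (complex_of_real x + c)"
      by simp
    ultimately show ?thesis
      by (simp only: diff_minus_eq_add)
  qed
  ultimately have "((\<lambda>x. Ln (complex_of_real (- x) - c) - complex_of_real (ln x))
      \<longlongrightarrow> - (\<i> * of_real (sgn (Im c) * pi))) at_top"
    by (simp add: algebra_simps)
  then show ?thesis
    unfolding filterlim_at_bot_mirror by simp
qed

text \<open>Partial fractions give a difference of logarithms as antiderivative; the horizontal
  lines x - c and x - d never meet the branch cut. The logarithmic growth cancels and only the
  arguments at -\<infinity> remain, so poles on the same side of the real line contribute 0.\<close>

lemma integral_inverse_quadratic_distinct:
  assumes c: "Im c \<noteq> 0" and d: "Im d \<noteq> 0" and "c \<noteq> d"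
  shows "(LINT x|lborel. 1 / ((complex_of_real x - c) * (complex_of_real x - d)))
    = \<i> * of_real ((sgn (Im c) - sgn (Im d)) * pi) / (c - d)"
proof -
  let ?F = "\<lambda>x. (Ln (complex_of_real x - c) - Ln (complex_of_real x - d)) / (c - d)"
  let ?L = "\<lambda>b. - (\<i> * complex_of_real (sgn (Im b) * pi))"
  have nz: "complex_of_real x - b \<notin> \<real>\<^sub>\<le>\<^sub>0" if "Im b \<noteq> 0" for x b
    using that by (auto simp: complex_nonpos_Reals_iff)
  have "(LINT x|lborel. 1 / ((complex_of_real x - c) * (complex_of_real x - d)))
      = 0 - (?L c - ?L d) / (c - d)"
  proof (rule integral_real_line_FTC[where F = ?F])
    fix x :: real
    have der: "((\<lambda>x. Ln (complex_of_real x - b)) has_vector_derivative 1 / (complex_of_real x - b)) (at x)"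
      if "Im b \<noteq> 0" for b
    proof -
      have "((\<lambda>z. Ln (z - b)) has_field_derivative 1 / (complex_of_real x - b)) (at (complex_of_real x))"
        using nz[OF that] by (auto intro!: derivative_eq_intros simp: field_simps)
      from has_vector_derivative_real_field[OF this] show ?thesis .
    qed
    have "(?F has_vector_derivative (1 / (complex_of_real x - c) - 1 / (complex_of_real x - d)) / (c - d)) (at x)"
      by (intro has_vector_derivative_divide has_vector_derivative_diff der c d)
    also have "(1 / (complex_of_real x - c) - 1 / (complex_of_real x - d)) / (c - d)
        = 1 / ((complex_of_real x - c) * (complex_of_real x - d))"
      using of_real_neq_nonreal[OF c, of x] of_real_neq_nonreal[OF d, of x] \<open>c \<noteq> d\<close>
      by (simp add: divide_simps)
    finally show "(?F has_vector_derivative 1 / ((complex_of_real x - c) * (complex_of_real x - d))) (at x)" .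
  next
    have "((\<lambda>x. ((Ln (complex_of_real x - c) - complex_of_real (ln x))
        - (Ln (complex_of_real x - d) - complex_of_real (ln x))) / (c - d)) \<longlongrightarrow> (0 - 0) / (c - d)) at_top"
      using \<open>c \<noteq> d\<close> by (intro tendsto_divide tendsto_diff tendsto_const tendsto_Ln_diff_ln_at_top c d) auto
    then show "(?F \<longlongrightarrow> 0) at_top"
      by simp
    have "((\<lambda>x. ((Ln (complex_of_real x - c) - complex_of_real (ln (- x)))
        - (Ln (complex_of_real x - d) - complex_of_real (ln (- x)))) / (c - d))
        \<longlongrightarrow> (?L c - ?L d) / (c - d)) at_bot"
      using \<open>c \<noteq> d\<close> by (intro tendsto_divide tendsto_diff tendsto_const tendsto_Ln_diff_ln_at_bot c d) auto
    then show "(?F \<longlongrightarrow> (?L c - ?L d) / (c - d)) at_bot"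
      by simp
  next
    show "continuous_on UNIV (\<lambda>x. 1 / ((complex_of_real x - c) * (complex_of_real x - d)))"
      using of_real_neq_nonreal[OF c] of_real_neq_nonreal[OF d]
      by (intro continuous_intros) auto
  qed (intro integrable_inverse_quadratic c d)
  then show ?thesis
    using \<open>c \<noteq> d\<close> by (simp add: field_simps)
qed

text \<open>The antiderivative -1 / (x - c) vanishes at both ends. This covers the coincidence of
  the two poles, which the logarithmic antiderivative cannot express.\<close>

lemma integral_inverse_square:
  assumes c: "Im c \<noteq> 0"
  shows "(LINT x|lborel. 1 / ((complex_of_real x - c) * (complex_of_real x - c))) = 0"
proof -
  let ?F = "\<lambda>x. - (1 / (complex_of_real x - c))"
  have "(LINT x|lborel. 1 / ((complex_of_real x - c) * (complex_of_real x - c))) = 0 - 0"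
  proof (rule integral_real_line_FTC[where F = ?F])
    fix x :: real
    have "((\<lambda>z. - (1 / (z - c))) has_field_derivative
        1 / ((complex_of_real x - c) * (complex_of_real x - c))) (at (complex_of_real x))"
      using of_real_neq_nonreal[OF c, of x] by (auto intro!: derivative_eq_intros)
    from has_vector_derivative_real_field[OF this]
    show "(?F has_vector_derivative 1 / ((complex_of_real x - c) * (complex_of_real x - c))) (at x)" .
  next
    have "filterlim (\<lambda>x::real. \<bar>x\<bar>) at_top at_bot"
      unfolding filterlim_at_bot_mirror using filterlim_abs_real by simp
    then have "filterlim (\<lambda>x. complex_of_real x) at_infinity at_bot"
      by (intro filterlim_norm_at_top_imp_at_infinity) simp
    then have "filterlim (\<lambda>x. - c + complex_of_real x) at_infinity at_bot"
      by (rule tendsto_add_filterlim_at_infinity[OF tendsto_const])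
    from tendsto_minus[OF tendsto_divide_0[OF tendsto_const[of 1] this]] show "(?F \<longlongrightarrow> 0) at_bot"
      by simp
    have "filterlim (\<lambda>x. - c + complex_of_real x) at_infinity at_top"
      by (rule tendsto_add_filterlim_at_infinity[OF tendsto_const filterlim_of_real_at_infinity])
    from tendsto_minus[OF tendsto_divide_0[OF tendsto_const[of 1] this]] show "(?F \<longlongrightarrow> 0) at_top"
      by simp
  next
    show "continuous_on UNIV (\<lambda>x. 1 / ((complex_of_real x - c) * (complex_of_real x - c)))"
      using of_real_neq_nonreal[OF c] by (intro continuous_intros) auto
  qed (intro integrable_inverse_quadratic c)
  then show ?thesis by simp
qed

section \<open>The Cauchy density and the mean of a simple pole\<close>

lemma cauchy_density_nonneg: "\<sigma> > 0 \<Longrightarrow> 0 \<le> cauchy_density \<mu> \<sigma> x"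
  by (simp add: cauchy_density_def)

lemma measurable_cauchy_density [measurable]: "cauchy_density \<mu> \<sigma> \<in> borel_measurable borel"
  unfolding cauchy_density_def[abs_def] by measurable

lemma cauchy_density_eq_norm:
  "cauchy_density \<mu> \<sigma> x = \<sigma> / pi /
    (norm (complex_of_real x - Complex \<mu> \<sigma>) * norm (complex_of_real x - Complex \<mu> \<sigma>))"
  by (simp add: cauchy_density_def cmod_power2 flip: power2_eq_square)

lemma integrable_cauchy_powr:
  assumes "\<sigma> > 0" "0 \<le> s" "s < 1"
  shows "integrable lborel (\<lambda>x. cauchy_density \<mu> \<sigma> x * norm (complex_of_real x + a) powr s)"
proof -
  have "integrable lborel (\<lambda>x. \<sigma> / pi * (norm (complex_of_real x + a) powr s /
    (norm (complex_of_real x - Complex \<mu> \<sigma>) * norm (complex_of_real x - Complex \<mu> \<sigma>))))"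
    using assms by (intro integrable_mult_right integrable_powr_inverse_quadratic) auto
  then show ?thesis
    by (simp add: cauchy_density_eq_norm mult_ac)
qed

text \<open>Partial fractions turn the Cauchy density into the difference of two simple poles, one in
  each half-plane; paired with the pole \<open>-\<delta>\<close> in the lower half-plane, only the upper one
  contributes.\<close>

lemma integral_cauchy_inverse:
  assumes "\<sigma> > 0" "Im \<delta> > 0"
  shows "(LINT x|lborel. cauchy_density \<mu> \<sigma> x *\<^sub>R (1 / (complex_of_real x + \<delta>)))
    = 1 / (Complex \<mu> \<sigma> + \<delta>)"
proof -
  let ?\<gamma> = "Complex \<mu> \<sigma>"
  define q where "q c x = 1 / ((complex_of_real x - c) * (complex_of_real x - (- \<delta>)))" for c x
  have q_eq: "q c x = 1 / (complex_of_real x - c) * (1 / (complex_of_real x + \<delta>))" for c x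
    by (simp add: q_def)
  have eq: "cauchy_density \<mu> \<sigma> x *\<^sub>R (1 / (complex_of_real x + \<delta>))
      = (q ?\<gamma> x - q (cnj ?\<gamma>) x) / (2 * pi * \<i>)" for x
  proof -
    have nz: "complex_of_real x - ?\<gamma> \<noteq> 0" "complex_of_real x - cnj ?\<gamma> \<noteq> 0"
        "complex_of_real x + \<delta> \<noteq> 0"
      using assms of_real_neq_nonreal[of ?\<gamma> x] of_real_neq_nonreal[of "cnj ?\<gamma>" x]
        of_real_plus_neq_0[of \<delta> x] by auto
    define P where "P = (complex_of_real x - ?\<gamma>) * (complex_of_real x - cnj ?\<gamma>)"
    have "P \<noteq> 0"
      using nz by (simp add: P_def del: complex_cnj)
    have "complex_of_real ((x - \<mu>)\<^sup>2 + \<sigma>\<^sup>2) = P"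
      by (simp add: P_def complex_eq_iff power2_eq_square algebra_simps)
    then have "complex_of_real (cauchy_density \<mu> \<sigma> x) = \<sigma> / (pi * P)"
      by (simp add: cauchy_density_def flip: of_real_power of_real_diff of_real_add)
    moreover have "?\<gamma> - cnj ?\<gamma> = 2 * \<i> * \<sigma>"
      by (simp add: complex_eq_iff)
    then have "1 / (complex_of_real x - ?\<gamma>) - 1 / (complex_of_real x - cnj ?\<gamma>) = 2 * \<i> * \<sigma> / P"
      unfolding P_def using nz by (simp add: divide_simps del: complex_cnj)
    ultimately have "complex_of_real (cauchy_density \<mu> \<sigma> x)
        = (1 / (complex_of_real x - ?\<gamma>) - 1 / (complex_of_real x - cnj ?\<gamma>)) / (2 * pi * \<i>)"
      using \<open>P \<noteq> 0\<close> by (simp del: complex_cnj)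
    then show ?thesis
      by (simp only: scaleR_conv_of_real q_eq left_diff_distrib times_divide_eq_left)
  qed
  have int: "integrable lborel (q c)" if "Im c \<noteq> 0" for c
    unfolding q_def using that assms by (intro integrable_inverse_quadratic) auto
  have 1: "integral\<^sup>L lborel (q ?\<gamma>) = 2 * pi * \<i> / (?\<gamma> + \<delta>)"
  proof -
    have "?\<gamma> \<noteq> - \<delta>"
      using assms by (auto simp: complex_eq_iff)
    then show ?thesis
      unfolding q_def using assms
      by (subst integral_inverse_quadratic_distinct) (auto simp: mult_ac)
  qed
  have 2: "integral\<^sup>L lborel (q (cnj ?\<gamma>)) = 0"
  \<comment> \<open>Both poles lie in the lower half-plane. They may coincide, namely when \<delta>
    = - cnj \<gamma>, and then form a double pole.\<close>
  proof (cases "cnj ?\<gamma> = - \<delta>")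
    case True
    then show ?thesis
      unfolding q_def using assms integral_inverse_square[of "- \<delta>"] by simp
  next
    case False
    then show ?thesis
      unfolding q_def using assms by (subst integral_inverse_quadratic_distinct) auto
  qed
  have "(LINT x|lborel. cauchy_density \<mu> \<sigma> x *\<^sub>R (1 / (complex_of_real x + \<delta>)))
      = (LINT x|lborel. (q ?\<gamma> x - q (cnj ?\<gamma>) x) / (2 * pi * \<i>))"
    by (simp only: eq)
  also have "\<dots> = (2 * pi * \<i> / (?\<gamma> + \<delta>) - 0) / (2 * pi * \<i>)"
    using assms by (simp add: int 1 2)
  finally show ?thesis
    by simp
qed

section \<open>Independence and moments\<close>

context prob_space
begin

text \<open>Values in a normed space are allowed because the lemma is applied to the complex
  variables \<open>Y j\<close>.\<close>

lemma indep_vars_sum':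
  fixes X :: "'i \<Rightarrow> 'a \<Rightarrow> 'b :: {second_countable_topology, real_normed_vector}"
  assumes I: "finite I" "i \<notin> I" and indep: "indep_vars (\<lambda>_. borel) X (insert i I)"
  shows "indep_var borel (X i) borel (\<lambda>\<omega>. \<Sum>i\<in>I. X i \<omega>)"
proof -
  have "indep_var
    borel ((\<lambda>f. f i) \<circ> (\<lambda>\<omega>. restrict (\<lambda>i. X i \<omega>) {i}))
    borel ((\<lambda>f. \<Sum>i\<in>I. f i) \<circ> (\<lambda>\<omega>. restrict (\<lambda>i. X i \<omega>) I))"
    using I by (intro indep_var_compose[OF indep_var_restrict[OF indep]]) auto
  also have "(\<lambda>f. f i) \<circ> (\<lambda>\<omega>. restrict (\<lambda>i. X i \<omega>) {i}) = X i"
    by auto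
  also have "(\<lambda>f. \<Sum>i\<in>I. f i) \<circ> (\<lambda>\<omega>. restrict (\<lambda>i. X i \<omega>) I) = (\<lambda>\<omega>. \<Sum>i\<in>I. X i \<omega>)"
    by (auto cong: rev_conj_cong)
  finally show ?thesis .
qed

text \<open>Under independence the joint law is the product of the marginal laws, so by Fubini the
  first variable can be integrated out while the second is frozen. This is how one sample point at a
  time gets replaced by its mean.\<close>

lemma indep_var_integral_fst:
  fixes f :: "'b \<times> 'b \<Rightarrow> 'd::{banach, second_countable_topology}"
  assumes indep: "indep_var S X T Y"
    and [measurable]: "f \<in> borel_measurable (S \<Otimes>\<^sub>M T)"
    and int: "integrable M (\<lambda>\<omega>. f (X \<omega>, Y \<omega>))"
    and g: "\<And>\<omega>. \<omega> \<in> space M \<Longrightarrow> (LINT \<omega>'|M. f (X \<omega>', Y \<omega>)) = g (Y \<omega>)"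
  shows "(LINT \<omega>|M. f (X \<omega>, Y \<omega>)) = (LINT \<omega>|M. g (Y \<omega>))"
proof -
  have [measurable]: "X \<in> measurable M S" "Y \<in> measurable M T"
    using indep by (blast dest: indep_var_rv1 indep_var_rv2)+
  interpret X: prob_space "distr M S X" by (rule prob_space_distr) fact
  interpret Y: prob_space "distr M T Y" by (rule prob_space_distr) fact
  interpret XY: pair_prob_space "distr M S X" "distr M T Y" ..
  have eq: "distr M S X \<Otimes>\<^sub>M distr M T Y = distr M (S \<Otimes>\<^sub>M T) (\<lambda>\<omega>. (X \<omega>, Y \<omega>))"
    using indep by (simp add: indep_var_distribution_eq)
  have "integrable (distr M S X \<Otimes>\<^sub>M distr M T Y) (case_prod (curry f))"
    unfolding eq using int by (simp add: integrable_distr_eq)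
  from XY.integral_snd[OF this]
  have "(LINT \<omega>|M. f (X \<omega>, Y \<omega>)) = (LINT y|distr M T Y. LINT x|distr M S X. f (x, y))"
    unfolding eq by (simp add: integral_distr)
  also have "\<dots> = (LINT \<omega>|M. LINT x|distr M S X. f (x, Y \<omega>))"
    by (rule integral_distr) measurable
  also have "\<dots> = (LINT \<omega>|M. g (Y \<omega>))"
  proof (rule Bochner_Integration.integral_cong)
    fix \<omega> assume \<omega>: "\<omega> \<in> space M"
    then have "Y \<omega> \<in> space T"
      by (rule measurable_space[rotated]) simp
    moreover from this have "(LINT x|distr M S X. f (x, Y \<omega>)) = (LINT \<omega>'|M. f (X \<omega>', Y \<omega>))"
      by (intro integral_distr) measurable
    ultimately show "(LINT x|distr M S X. f (x, Y \<omega>)) = g (Y \<omega>)"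
      using \<omega> by (simp add: g)
  qed simp
  finally show ?thesis .
qed

lemma
  fixes A B :: "'a \<Rightarrow> real"
  assumes indep: "indep_var borel A borel B" and "\<And>\<omega>. \<bar>A \<omega>\<bar> \<le> a" "\<And>\<omega>. \<bar>B \<omega>\<bar> \<le> b"
  shows integrable_indep_bounded_power: "integrable M (\<lambda>\<omega>. A \<omega> ^ k * B \<omega> ^ l)"
    and integral_indep_bounded_power:
      "expectation (\<lambda>\<omega>. A \<omega> ^ k * B \<omega> ^ l) = expectation (\<lambda>\<omega>. A \<omega> ^ k) * expectation (\<lambda>\<omega>. B \<omega> ^ l)"
proof -
  have [measurable]: "A \<in> borel_measurable M" "B \<in> borel_measurable M"
    using indep by (blast dest: indep_var_rv1 indep_var_rv2)+
  have A: "integrable M (\<lambda>\<omega>. A \<omega> ^ k)"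
    by (rule integrable_const_bound[where B = "a ^ k"]) (auto simp: power_abs assms intro!: power_mono)
  have B: "integrable M (\<lambda>\<omega>. B \<omega> ^ l)"
    by (rule integrable_const_bound[where B = "b ^ l"]) (auto simp: power_abs assms intro!: power_mono)
  have "indep_var borel ((\<lambda>x. x ^ k) \<circ> A) borel ((\<lambda>x. x ^ l) \<circ> B)"
    by (rule indep_var_compose[OF indep]) auto
  then have AB: "indep_var borel (\<lambda>\<omega>. A \<omega> ^ k) borel (\<lambda>\<omega>. B \<omega> ^ l)"
    by (simp add: comp_def)
  show "integrable M (\<lambda>\<omega>. A \<omega> ^ k * B \<omega> ^ l)"
    by (rule indep_var_integrable[OF AB A B])
  show "expectation (\<lambda>\<omega>. A \<omega> ^ k * B \<omega> ^ l) = expectation (\<lambda>\<omega>. A \<omega> ^ k) * expectation (\<lambda>\<omega>. B \<omega> ^ l)"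
    by (rule indep_var_lebesgue_integral[OF AB A B])
qed

text \<open>Induction adds one term \<open>Z i\<close> to the sum \<open>S\<close> of the others.
  Mixed terms in which \<open>Z i\<close> or \<open>S\<close> has exponent 1 vanish, both being
  centered. With n = \<open>card I\<close>, the fourth moment grows by at most c^4 + 6 n c^4, while
  3 c^4 n^2 grows by 3 c^4 (2 n + 1); this explains the constant 3.\<close>

lemma indep_bounded_centered_sum_moments:
  fixes Z :: "'i \<Rightarrow> 'a \<Rightarrow> real"
  assumes "finite I" "indep_vars (\<lambda>_. borel) Z I"
    and "\<And>i. i \<in> I \<Longrightarrow> expectation (Z i) = 0" and "\<And>i \<omega>. i \<in> I \<Longrightarrow> \<bar>Z i \<omega>\<bar> \<le> c"
  shows "expectation (\<lambda>\<omega>. (\<Sum>i\<in>I. Z i \<omega>)\<^sup>2) = (\<Sum>i\<in>I. expectation (\<lambda>\<omega>. (Z i \<omega>)\<^sup>2)) \<and>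
    expectation (\<lambda>\<omega>. (\<Sum>i\<in>I. Z i \<omega>) ^ 4) \<le> 3 * c ^ 4 * (real (card I))\<^sup>2"
  using assms
proof (induction I)
  case empty
  then show ?case by simp
next
  case (insert i I)
  define S where "S = (\<lambda>\<omega>. \<Sum>i\<in>I. Z i \<omega>)"
  let ?n = "real (card I)"
  have "indep_vars (\<lambda>_. borel) Z I"
    using insert.prems(1) by (rule indep_vars_subset) auto
  then have IH2: "expectation (\<lambda>\<omega>. (S \<omega>)\<^sup>2) = (\<Sum>i\<in>I. expectation (\<lambda>\<omega>. (Z i \<omega>)\<^sup>2))"
    and IH4: "expectation (\<lambda>\<omega>. (S \<omega>) ^ 4) \<le> 3 * c ^ 4 * ?n\<^sup>2"
    using insert by (auto simp: S_def)
  have indep: "indep_var borel (Z i) borel S"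
    unfolding S_def by (rule indep_vars_sum) (use insert in auto)
  have bZ: "\<bar>Z i \<omega>\<bar> \<le> c" for \<omega>
    using insert by simp
  have bS: "\<bar>S \<omega>\<bar> \<le> ?n * c" for \<omega>
    unfolding S_def
    by (rule order.trans[OF sum_abs sum_bounded_above[of I, THEN order.trans]]) (use insert in auto)
  note int = integrable_indep_bounded_power[OF indep bZ bS]
  note eq = integral_indep_bounded_power[OF indep bZ bS]
  have int': "integrable M (\<lambda>\<omega>. Z i \<omega> ^ k)" "integrable M (\<lambda>\<omega>. S \<omega> ^ k)" for k
    using int[of k 0] int[of 0 k] by simp_all
  have bnd: "expectation (\<lambda>\<omega>. (Z j \<omega>) ^ k) \<le> c ^ k" if "j \<in> insert i I" "even k" for j k
  proof -
    have [measurable]: "Z j \<in> borel_measurable M"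
      using insert.prems(1) that by (auto simp: indep_vars_def)
    have le: "(Z j \<omega>) ^ k \<le> c ^ k" for \<omega>
      using power_mono[OF insert.prems(3)[OF that(1)], of \<omega> k] that(2) by (simp add: power_even_abs)
    have "integrable M (\<lambda>\<omega>. (Z j \<omega>) ^ k)"
      by (rule integrable_const_bound[where B = "c ^ k"]) (use le that(2) in auto)
    from integral_mono[OF this integrable_const le] show ?thesis
      by (simp add: prob_space)
  qed
  have EZ: "expectation (Z i) = 0"
    using insert by simp
  have c2: "0 \<le> c\<^sup>2" "0 \<le> c ^ 4" by simp_all
  have ES2: "expectation (\<lambda>\<omega>. (S \<omega>)\<^sup>2) \<le> ?n * c\<^sup>2"
    unfolding IH2 by (rule sum_bounded_above) (use bnd[of _ 2] in auto)
  have sum: "(\<Sum>i\<in>insert i I. Z i \<omega>) = Z i \<omega> + S \<omega>" for \<omega>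
    using insert by (simp add: S_def)
  \<comment> \<open>Exponents \<open>^ 1\<close> are written out so that the mixed terms match the
    product form of \<open>int\<close> and \<open>eq\<close>.\<close>
  have "(Z i \<omega> + S \<omega>)\<^sup>2 = (Z i \<omega>)\<^sup>2 + 2 * (Z i \<omega> ^ 1 * S \<omega> ^ 1) + (S \<omega>)\<^sup>2" for \<omega>
    by (simp add: power2_eq_square algebra_simps)
  then have "expectation (\<lambda>\<omega>. (Z i \<omega> + S \<omega>)\<^sup>2)
      = expectation (\<lambda>\<omega>. (Z i \<omega>)\<^sup>2) + 2 * expectation (\<lambda>\<omega>. Z i \<omega> ^ 1 * S \<omega> ^ 1) + expectation (\<lambda>\<omega>. (S \<omega>)\<^sup>2)"
    by (simp only: Bochner_Integration.integral_add Bochner_Integration.integrable_add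
        integrable_mult_right integral_mult_right_zero int int')
  then have 2: "expectation (\<lambda>\<omega>. (Z i \<omega> + S \<omega>)\<^sup>2)
      = expectation (\<lambda>\<omega>. (Z i \<omega>)\<^sup>2) + expectation (\<lambda>\<omega>. (S \<omega>)\<^sup>2)"
    unfolding eq by (simp add: EZ)
  have "(Z i \<omega> + S \<omega>) ^ 4 = (Z i \<omega>) ^ 4 + 4 * (Z i \<omega> ^ 3 * S \<omega> ^ 1) + 6 * (Z i \<omega> ^ 2 * S \<omega> ^ 2)
      + 4 * (Z i \<omega> ^ 1 * S \<omega> ^ 3) + (S \<omega>) ^ 4" for \<omega>
    by (simp add: eval_nat_numeral algebra_simps)
  then have "expectation (\<lambda>\<omega>. (Z i \<omega> + S \<omega>) ^ 4) = expectation (\<lambda>\<omega>. (Z i \<omega>) ^ 4)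
      + 4 * expectation (\<lambda>\<omega>. Z i \<omega> ^ 3 * S \<omega> ^ 1) + 6 * expectation (\<lambda>\<omega>. Z i \<omega> ^ 2 * S \<omega> ^ 2)
      + 4 * expectation (\<lambda>\<omega>. Z i \<omega> ^ 1 * S \<omega> ^ 3) + expectation (\<lambda>\<omega>. (S \<omega>) ^ 4)"
    by (simp only: Bochner_Integration.integral_add Bochner_Integration.integrable_add
        integrable_mult_right integral_mult_right_zero int int')
  also have "expectation (\<lambda>\<omega>. Z i \<omega> ^ 3 * S \<omega> ^ 1) = 0"
  proof -
    have "expectation S = 0"
      unfolding S_def
    proof (subst Bochner_Integration.integral_sum)
      fix j assume j: "j \<in> I"
      then have [measurable]: "Z j \<in> borel_measurable M"
        using insert.prems(1) by (auto simp: indep_vars_def)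
      show "integrable M (Z j)"
        by (rule integrable_const_bound[where B = c]) (use j insert in auto)
    qed (use insert in auto)
    then show ?thesis
      unfolding eq by simp
  qed
  also have "expectation (\<lambda>\<omega>. Z i \<omega> ^ 1 * S \<omega> ^ 3) = 0"
    unfolding eq by (simp add: EZ)
  also have "expectation (\<lambda>\<omega>. Z i \<omega> ^ 2 * S \<omega> ^ 2) \<le> c\<^sup>2 * (?n * c\<^sup>2)"
    unfolding eq by (intro mult_mono bnd ES2) auto
  also have "expectation (\<lambda>\<omega>. (Z i \<omega>) ^ 4) \<le> c ^ 4"
    by (intro bnd) auto
  also note IH4
  finally have "expectation (\<lambda>\<omega>. (Z i \<omega> + S \<omega>) ^ 4)
      \<le> c ^ 4 + 4 * 0 + 6 * (c\<^sup>2 * (?n * c\<^sup>2)) + 4 * 0 + 3 * c ^ 4 * ?n\<^sup>2"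
    by simp
  also have "\<dots> \<le> 3 * c ^ 4 * (?n + 1)\<^sup>2"
    using c2 by (simp add: power2_eq_square power4_eq_xxxx algebra_simps)
  finally show ?case
    unfolding sum 2 IH2 using insert by (simp add: add.commute)
qed

section \<open>Convergence of expectations from second moment bounds\<close>

text \<open>Bounded second moments give uniform integrability. Truncation at a level t is handled by
  dominated convergence, and the excess over t is at most f^2 / t.\<close>

lemma tendsto_expectation_0:
  fixes f :: "nat \<Rightarrow> 'a \<Rightarrow> real"
  assumes [measurable]: "\<And>n. f n \<in> borel_measurable M" and nonneg: "\<And>n \<omega>. 0 \<le> f n \<omega>"
    and lim: "AE \<omega> in M. (\<lambda>n. f n \<omega>) \<longlonglongrightarrow> 0"
    and bound: "\<forall>\<^sub>F n in sequentially. integrable M (\<lambda>\<omega>. (f n \<omega>)\<^sup>2) \<and> expectation (\<lambda>\<omega>. (f n \<omega>)\<^sup>2) \<le> K"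
  shows "(\<lambda>n. expectation (f n)) \<longlonglongrightarrow> 0"
proof (rule LIMSEQ_I)
  fix e :: real assume "0 < e"
  \<comment> \<open>The level makes (\<bar>K\<bar> + 1) / t equal to e / 2; the added 1 keeps t
    positive when K = 0.\<close>
  define t where "t = (\<bar>K\<bar> + 1) * (2 / e)"
  have "t > 0" using \<open>0 < e\<close> by (simp add: t_def)
  have "(\<lambda>n. expectation (\<lambda>\<omega>. min (f n \<omega>) t)) \<longlonglongrightarrow> expectation (\<lambda>\<omega>. 0)"
  proof (rule integral_dominated_convergence[where w = "\<lambda>_. t"])
    show "AE \<omega> in M. (\<lambda>n. min (f n \<omega>) t) \<longlonglongrightarrow> 0"
      using lim
    proof eventually_elim
      case (elim \<omega>)
      from tendsto_min[OF this tendsto_const[of t]] show ?case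
        using \<open>t > 0\<close> by simp
    qed
  qed (use nonneg \<open>t > 0\<close> in auto)
  then have "\<forall>\<^sub>F n in sequentially. expectation (\<lambda>\<omega>. min (f n \<omega>) t) < e / 2"
    by (intro order_tendstoD) (use \<open>0 < e\<close> in auto)
  with bound have "\<forall>\<^sub>F n in sequentially. norm (expectation (f n) - 0) < e"
  proof eventually_elim
    case (elim n)
    have int: "integrable M (\<lambda>\<omega>. min (f n \<omega>) t)"
      by (rule integrable_const_bound[where B = t]) (use nonneg \<open>t > 0\<close> in auto)
    have le: "f n \<omega> \<le> min (f n \<omega>) t + (f n \<omega>)\<^sup>2 / t" for \<omega>
    proof (cases "f n \<omega> \<le> t")
      case False
      then have "f n \<omega> * t \<le> (f n \<omega>)\<^sup>2"
        using \<open>t > 0\<close> by (simp add: power2_eq_square)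
      then have "f n \<omega> \<le> (f n \<omega>)\<^sup>2 / t"
        using \<open>t > 0\<close> by (simp add: pos_le_divide_eq)
      then show ?thesis
        using False \<open>t > 0\<close> by simp
    qed (use \<open>t > 0\<close> in simp)
    have int': "integrable M (\<lambda>\<omega>. min (f n \<omega>) t + (f n \<omega>)\<^sup>2 / t)"
      using int elim(1) by simp
    have "integrable M (f n)"
      by (rule Bochner_Integration.integrable_bound[OF int'])
        (use le nonneg in \<open>auto intro: order.trans[OF _ abs_ge_self]\<close>)
    from integral_mono[OF this int' le]
    have "expectation (f n) \<le> expectation (\<lambda>\<omega>. min (f n \<omega>) t) + expectation (\<lambda>\<omega>. (f n \<omega>)\<^sup>2) / t"
      using int elim(1) by simp
    also have "expectation (\<lambda>\<omega>. (f n \<omega>)\<^sup>2) / t \<le> (\<bar>K\<bar> + 1) / t"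
      using elim(1) \<open>t > 0\<close> by (intro divide_right_mono) auto
    also have "\<dots> = e / 2"
    proof -
      have cancel: "k / (k * (2 / e)) = e / 2" if "k > 0" for k
        using that by simp
      show ?thesis
        unfolding t_def by (rule cancel) simp
    qed
    finally show ?case
      using elim(2) nonneg by simp
  qed
  then show "\<exists>N. \<forall>n\<ge>N. norm (expectation (f n) - 0) < e"
    by (simp add: eventually_sequentially)
qed

end

text \<open>A Cauchy-Schwarz argument in the form 2 \<bar>f g\<bar> \<le> e f^2 + g^2 / e, with a
  small weight e on the factor that is merely bounded in the mean square.\<close>

lemma tendsto_integral_mult_0:
  fixes f g :: "nat \<Rightarrow> 'a \<Rightarrow> real"
  assumes "\<And>n. f n \<in> borel_measurable M" "\<And>n. g n \<in> borel_measurable M"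
    and f: "\<forall>\<^sub>F n in sequentially. integrable M (\<lambda>x. (f n x)\<^sup>2) \<and> (LINT x|M. (f n x)\<^sup>2) \<le> K"
    and g: "\<forall>\<^sub>F n in sequentially. integrable M (\<lambda>x. (g n x)\<^sup>2)"
    and g0: "(\<lambda>n. LINT x|M. (g n x)\<^sup>2) \<longlonglongrightarrow> 0"
  shows "(\<lambda>n. LINT x|M. f n x * g n x) \<longlonglongrightarrow> 0"
proof (rule LIMSEQ_I)
  fix r :: real assume "0 < r"
  \<comment> \<open>With this weight the f-part is at most r, and eventually the g-part is below r
    as well; half of their sum is then below r.\<close>
  define e where "e = r / (\<bar>K\<bar> + 1)"
  have "e > 0" using \<open>0 < r\<close> by (simp add: e_def)
  have "\<forall>\<^sub>F n in sequentially. (LINT x|M. (g n x)\<^sup>2) < e * r"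
    by (rule order_tendstoD[OF g0]) (use \<open>0 < r\<close> \<open>0 < e\<close> in auto)
  with f g have "\<forall>\<^sub>F n in sequentially. norm ((LINT x|M. f n x * g n x) - 0) < r"
  proof eventually_elim
    case (elim n)
    have "norm (LINT x|M. f n x * g n x) \<le> (LINT x|M. (e * (f n x)\<^sup>2 + (g n x)\<^sup>2 / e) / 2)"
    proof (rule order.trans[OF integral_norm_bound integral_mono])
      show int: "integrable M (\<lambda>x. (e * (f n x)\<^sup>2 + (g n x)\<^sup>2 / e) / 2)"
        using elim by simp
      show le: "norm (f n x * g n x) \<le> (e * (f n x)\<^sup>2 + (g n x)\<^sup>2 / e) / 2" for x
      proof -
        have "0 \<le> (e * \<bar>f n x\<bar> - \<bar>g n x\<bar>)\<^sup>2 / e"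
          using \<open>e > 0\<close> by simp
        also have "\<dots> = e * (f n x)\<^sup>2 + (g n x)\<^sup>2 / e - 2 * \<bar>f n x * g n x\<bar>"
          using \<open>e > 0\<close> by (simp add: power2_diff power_mult_distrib abs_mult field_simps power2_eq_square)
        finally show ?thesis by simp
      qed
      show "integrable M (\<lambda>x. norm (f n x * g n x))"
        by (rule Bochner_Integration.integrable_bound[OF int])
          (use le assms(1,2) in \<open>auto intro!: order.trans[OF _ abs_ge_self] borel_measurable_times borel_measurable_norm\<close>)
    qed
    also have "\<dots> = (e * (LINT x|M. (f n x)\<^sup>2) + (LINT x|M. (g n x)\<^sup>2) / e) / 2"
      using elim by simp
    also have "e * (LINT x|M. (f n x)\<^sup>2) \<le> e * (\<bar>K\<bar> + 1)"
      using elim(1) \<open>e > 0\<close> by (intro mult_left_mono) auto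
    also have "e * (\<bar>K\<bar> + 1) = r"
      by (simp add: e_def)
    finally have "norm (LINT x|M. f n x * g n x) \<le> (r + (LINT x|M. (g n x)\<^sup>2) / e) / 2"
      by simp
    moreover have "(LINT x|M. (g n x)\<^sup>2) / e < r"
      using elim(3) \<open>e > 0\<close> by (simp add: field_simps)
    ultimately show ?case by simp
  qed
  then show "\<exists>N. \<forall>n\<ge>N. norm ((LINT x|M. f n x * g n x) - 0) < r"
    by (simp add: eventually_sequentially)
qed

section \<open>The reciprocal of the sample mean of \<open>1 / (X + \<alpha>)\<close>\<close>

locale cauchy_sample = prob_space M for M :: "'a measure" +
  fixes X :: "nat \<Rightarrow> 'a \<Rightarrow> real" and \<mu> \<sigma> :: real and \<alpha> :: complex
  assumes \<sigma>_pos: "\<sigma> > 0"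
    and indep_X: "indep_vars (\<lambda>_. borel) X {1..}"
    and distributed_X: "\<And>i. i \<ge> 1 \<Longrightarrow> distributed M lborel (X i) (\<lambda>x. ennreal (cauchy_density \<mu> \<sigma> x))"
    and Im_\<alpha>: "Im \<alpha> > 0"
begin

abbreviation \<gamma> :: complex where "\<gamma> \<equiv> Complex \<mu> \<sigma>"

definition \<beta> :: complex where "\<beta> = \<gamma> + \<alpha>"

definition m :: complex where "m = 1 / \<beta>"

definition Y :: "nat \<Rightarrow> 'a \<Rightarrow> complex" where "Y j \<omega> = 1 / (complex_of_real (X j \<omega>) + \<alpha>)"

definition avg :: "nat \<Rightarrow> 'a \<Rightarrow> complex" where "avg n \<omega> = (\<Sum>j=1..n. Y j \<omega>) / of_nat n"

lemma Im_\<beta>: "Im \<beta> = \<sigma> + Im \<alpha>"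
  by (simp add: \<beta>_def)

lemma \<beta>_nonzero: "\<beta> \<noteq> 0"
  using Im_\<beta> \<sigma>_pos Im_\<alpha> by auto

lemma m_nonzero: "m \<noteq> 0"
  using \<beta>_nonzero by (simp add: m_def)

lemma Im_m_neg: "Im m < 0"
  unfolding m_def Im_inverse_eq using \<beta>_nonzero \<sigma>_pos Im_\<alpha>
  by (intro mult_neg_pos) (simp_all add: Im_\<beta>)

lemma denominator_nonzero: "complex_of_real x + \<alpha> \<noteq> 0"
  using Im_\<alpha> by (intro of_real_plus_neq_0) simp

lemma Y_nonzero: "Y j \<omega> \<noteq> 0"
  by (simp add: Y_def denominator_nonzero)

lemma Im_Y: "Im (Y j \<omega>) = - Im \<alpha> * (norm (Y j \<omega>))\<^sup>2"
  unfolding Y_def Im_inverse_eq by simp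

text \<open>The lower half-plane is closed under addition and also contains \<open>m\<close>.
  Nonempty sums of points \<open>Y j\<close> and \<open>m\<close> therefore stay in it, as
  \<open>expectation_inverse_Y_plus\<close> demands of its b.\<close>

lemma Im_Y_neg: "Im (Y j \<omega>) < 0"
  unfolding Im_Y using Im_\<alpha> Y_nonzero by simp

lemma Im_sum_Y_nonpos: "(\<Sum>j\<in>J. Im (Y j \<omega>)) \<le> 0"
  by (rule sum_nonpos) (simp add: Im_Y_neg less_imp_le)

lemma norm_Y_le: "norm (Y j \<omega>) \<le> 1 / Im \<alpha>"
  unfolding Y_def using Im_\<alpha> by (rule norm_inverse_shift_le)

lemma measurable_X [measurable]: "j \<ge> 1 \<Longrightarrow> X j \<in> borel_measurable M"
  using distributed_measurable[OF distributed_X] by simp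

lemma measurable_Y [measurable]: "j \<ge> 1 \<Longrightarrow> Y j \<in> borel_measurable M"
  unfolding Y_def[abs_def] by measurable

lemma measurable_sum_Y [measurable]: "(\<lambda>\<omega>. \<Sum>j\<in>{Suc k..n}. Y j \<omega>) \<in> borel_measurable M"
  by (rule borel_measurable_sum) auto

lemma measurable_avg [measurable]: "avg n \<in> borel_measurable M"
  unfolding avg_def[abs_def] One_nat_def by measurable

section \<open>Means of functions of a single sample point\<close>

lemma
  fixes g :: "real \<Rightarrow> 'b::{banach, second_countable_topology}"
  assumes "j \<ge> 1" and [measurable]: "g \<in> borel_measurable borel"
  shows integrable_X_iff:
      "integrable M (\<lambda>\<omega>. g (X j \<omega>)) \<longleftrightarrow> integrable lborel (\<lambda>x. cauchy_density \<mu> \<sigma> x *\<^sub>R g x)"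
    and expectation_X: "(LINT \<omega>|M. g (X j \<omega>)) = (LINT x|lborel. cauchy_density \<mu> \<sigma> x *\<^sub>R g x)"
proof -
  have X: "X j \<in> measurable M lborel"
    using assms by simp
  have g: "g \<in> borel_measurable lborel"
    by simp
  have distr: "distr M lborel (X j) = density lborel (\<lambda>x. ennreal (cauchy_density \<mu> \<sigma> x))"
    using distributed_X[OF assms(1)] by (rule distributed_distr_eq_density)
  have nn: "AE x in lborel. 0 \<le> cauchy_density \<mu> \<sigma> x"
    by (simp add: cauchy_density_nonneg \<sigma>_pos)
  show "integrable M (\<lambda>\<omega>. g (X j \<omega>)) \<longleftrightarrow> integrable lborel (\<lambda>x. cauchy_density \<mu> \<sigma> x *\<^sub>R g x)"
    using integrable_distr_eq[OF X g] integrable_density[OF _ _ nn, of g]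
    by (simp add: distr)
  show "(LINT \<omega>|M. g (X j \<omega>)) = (LINT x|lborel. cauchy_density \<mu> \<sigma> x *\<^sub>R g x)"
    using integral_distr[OF X g] integral_density[OF _ _ nn, of g]
    by (simp add: distr)
qed

lemma integrable_inverse_shift:
  assumes "j \<ge> 1" "Im \<delta> > 0"
  shows "integrable M (\<lambda>\<omega>. 1 / (complex_of_real (X j \<omega>) + \<delta>))"
  using assms norm_inverse_shift_le[OF assms(2)]
  by (intro integrable_const_bound[where B = "1 / Im \<delta>"]) auto

lemma expectation_inverse_shift:
  assumes "j \<ge> 1" "Im \<delta> > 0"
  shows "expectation (\<lambda>\<omega>. 1 / (complex_of_real (X j \<omega>) + \<delta>)) = 1 / (\<gamma> + \<delta>)"
  using expectation_X[OF assms(1), of "\<lambda>x. 1 / (complex_of_real x + \<delta>)"]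
    integral_cauchy_inverse[OF \<sigma>_pos assms(2)] by simp

lemma integrable_Y: "j \<ge> 1 \<Longrightarrow> integrable M (Y j)"
  unfolding Y_def[abs_def] by (rule integrable_inverse_shift[OF _ Im_\<alpha>])

lemma expectation_Y: "j \<ge> 1 \<Longrightarrow> expectation (Y j) = m"
  unfolding Y_def[abs_def] m_def \<beta>_def by (rule expectation_inverse_shift[OF _ Im_\<alpha>])

text \<open>As a function of \<open>X j\<close>, the quantity \<open>1 / (Y j + b)\<close> is a Moebius map
  with its pole in the lower half-plane, so its mean is again its value at \<open>\<gamma>\<close>.\<close>

lemma expectation_inverse_Y_plus:
  assumes "j \<ge> 1" "Im b < 0"
  shows "expectation (\<lambda>\<omega>. 1 / (Y j \<omega> + b)) = 1 / (m + b)"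
proof -
  have "b \<noteq> 0"
    using assms by auto
  \<comment> \<open>The denominator 1 / (z + \<alpha>) + b vanishes exactly at z = -\<delta>. Since
    Im b < 0 implies Im (1 / b) > 0, this pole lies below the real line.\<close>
  define \<delta> where "\<delta> = \<alpha> + 1 / b"
  have "Im (1 / b) > 0"
    unfolding Im_inverse_eq using assms \<open>b \<noteq> 0\<close> by (simp add: mult_neg_pos)
  then have \<delta>: "Im \<delta> > 0"
    using Im_\<alpha> by (simp add: \<delta>_def)
  have moebius: "1 / (1 / (z + \<alpha>) + b) = 1 / b - 1 / b\<^sup>2 * (1 / (z + \<delta>))"
    if "z + \<alpha> \<noteq> 0" "z + \<delta> \<noteq> 0" for z
  proof -
    have "b * (z + \<delta>) = 1 + b * (z + \<alpha>)"
      using \<open>b \<noteq> 0\<close> by (simp add: \<delta>_def distrib_left)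
    then have "1 / (z + \<alpha>) + b = b * (z + \<delta>) / (z + \<alpha>)"
      using that by (simp add: add_divide_distrib)
    then have "1 / (1 / (z + \<alpha>) + b) = (z + \<alpha>) / (b * (z + \<delta>))"
      by simp
    also have "\<dots> = (z + \<delta> - 1 / b) / (b * (z + \<delta>))"
      by (simp add: \<delta>_def)
    also have "\<dots> = 1 / b - 1 / b\<^sup>2 * (1 / (z + \<delta>))"
      using that \<open>b \<noteq> 0\<close> by (simp add: diff_divide_distrib power2_eq_square)
    finally show ?thesis .
  qed
  have "1 / (Y j \<omega> + b) = 1 / b - 1 / b\<^sup>2 * (1 / (complex_of_real (X j \<omega>) + \<delta>))" for \<omega>
    unfolding Y_def using \<delta> by (intro moebius denominator_nonzero of_real_plus_neq_0) simp
  then have "expectation (\<lambda>\<omega>. 1 / (Y j \<omega> + b)) = 1 / b - 1 / b\<^sup>2 * (1 / (\<gamma> + \<delta>))"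
    using integrable_inverse_shift[OF assms(1) \<delta>] expectation_inverse_shift[OF assms(1) \<delta>]
    by (simp only: Bochner_Integration.integral_diff integrable_const integrable_mult_right
        integral_mult_right_zero lebesgue_integral_const prob_space scaleR_one)
  \<comment> \<open>The same identity, now read backwards at z = \<gamma>, returns the value of the
    original map.\<close>
  also have "\<dots> = 1 / (1 / (\<gamma> + \<alpha>) + b)"
  proof (rule moebius[symmetric])
    show "\<gamma> + \<alpha> \<noteq> 0"
      using \<beta>_nonzero by (simp add: \<beta>_def)
    show "\<gamma> + \<delta> \<noteq> 0"
      using \<delta> \<sigma>_pos by (auto simp: complex_eq_iff)
  qed
  finally show ?thesis
    by (simp add: m_def \<beta>_def)
qed

lemma indep_Y: "indep_vars (\<lambda>_. borel) Y {1..}"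
  unfolding Y_def[abs_def] by (rule indep_vars_compose2[OF indep_X]) measurable

section \<open>A lower bound for the sample mean and the moments of its reciprocal\<close>

text \<open>By \<open>Im_Y\<close>, -Im (\<open>avg n\<close>) is Im \<alpha> times the arithmetic
  mean of the squared moduli of the \<open>Y j\<close>; AM-GM bounds this from below by the
  geometric mean.\<close>

lemma avg_lower_bound:
  assumes "n \<ge> 1"
  shows "Im \<alpha> * (\<Prod>j=1..n. (norm (Y j \<omega>))\<^sup>2) powr (1 / real n) \<le> norm (avg n \<omega>)"
proof -
  have "Im \<alpha> * (\<Prod>j=1..n. (norm (Y j \<omega>))\<^sup>2) powr (1 / real n)
      \<le> Im \<alpha> * (\<Sum>j=1..n. (norm (Y j \<omega>))\<^sup>2 / real n)"
    using arith_geom_mean[of "{1..n}" "\<lambda>j. (norm (Y j \<omega>))\<^sup>2"] assms Im_\<alpha>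
    by (intro mult_left_mono) auto
  also have "\<dots> = - Im (avg n \<omega>)"
    by (simp add: avg_def Im_Y sum_negf sum_distrib_left sum_divide_distrib Im_divide_of_nat)
  also have "\<dots> \<le> norm (avg n \<omega>)"
    using abs_Im_le_cmod[of "avg n \<omega>"] by simp
  finally show ?thesis .
qed

lemma avg_nonzero:
  assumes "n \<ge> 1"
  shows "avg n \<omega> \<noteq> 0"
proof -
  have "0 < Im \<alpha> * (\<Prod>j=1..n. (norm (Y j \<omega>))\<^sup>2) powr (1 / real n)"
    using Im_\<alpha> Y_nonzero by (simp add: prod_zero_iff)
  with avg_lower_bound[OF assms, of \<omega>] show ?thesis
    by auto
qed

text \<open>Because X / (X + \<alpha>) = 1 - \<alpha> / (X + \<alpha>), the numerator is n minus
  \<alpha> times the denominator.\<close>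

lemma cauchy_estimator_eq:
  assumes "n \<ge> 1"
  shows "cauchy_estimator \<alpha> X n \<omega> = 1 / avg n \<omega> - \<alpha>"
proof -
  define S where "S = (\<Sum>j=1..n. Y j \<omega>)"
  have "S \<noteq> 0"
    using avg_nonzero[OF assms, of \<omega>] by (auto simp: avg_def S_def)
  have "complex_of_real (X j \<omega>) / (complex_of_real (X j \<omega>) + \<alpha>) = 1 - \<alpha> * Y j \<omega>" for j
    using denominator_nonzero[of "X j \<omega>"] by (simp add: Y_def field_simps)
  then have "(\<Sum>j=1..n. complex_of_real (X j \<omega>) / (complex_of_real (X j \<omega>) + \<alpha>)) = of_nat n - \<alpha> * S"
    by (simp add: S_def sum_subtractf sum_distrib_left)
  then have "cauchy_estimator \<alpha> X n \<omega> = (of_nat n - \<alpha> * S) / S"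
    by (simp add: cauchy_estimator_def S_def Y_def)
  also have "\<dots> = 1 / avg n \<omega> - \<alpha>"
    using \<open>S \<noteq> 0\<close> unfolding avg_def S_def[symmetric] by (simp add: diff_divide_distrib)
  finally show ?thesis .
qed

text \<open>The exponent must be below 1 for the integral to be finite. The p-th moment of
  \<open>1 / avg n\<close> leads to exponent 2 p / n in each factor, and 2/3 is the least choice
  that admits p = 1 with n = 3.\<close>

definition \<tau> :: real where
  "\<tau> = (LINT x|lborel. cauchy_density \<mu> \<sigma> x * norm (complex_of_real x + \<alpha>) powr (2 / 3))"

text \<open>Free of n: the n factors each contribute at most exp (q (\<tau> - 1)) with q = 3 p / n,
  so their product is exp (3 p (\<tau> - 1)).\<close>

definition inverse_moment_bound :: "real \<Rightarrow> real" where
  "inverse_moment_bound p = Im \<alpha> powr - p * exp (3 * p * (\<tau> - 1))"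

text \<open>By the AM-GM inequality \<open>1 / avg n\<close> is dominated by a product of independent factors,
  each a small power of \<open>norm (X j + \<alpha>)\<close>; a power below \<open>2/3\<close> is affinely dominated by the power
  \<open>2/3\<close>, which keeps the product of the means bounded as \<open>n\<close> grows.\<close>

lemma inverse_avg_moment:
  assumes "p > 0" "n \<ge> 1" "3 * p \<le> real n"
  shows "integrable M (\<lambda>\<omega>. norm (1 / avg n \<omega>) powr p) \<and>
    expectation (\<lambda>\<omega>. norm (1 / avg n \<omega>) powr p) \<le> inverse_moment_bound p"
proof -
  \<comment> \<open>Chosen so that \<open>T j\<close> to the power q is the modulus of X j +
    \<alpha> to the power 2 p / n. The hypothesis 3 p \<le> n says q \<le> 1, as the affine bound
    requires.\<close>
  define q where "q = 3 * p / real n"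
  have q: "0 \<le> q" "q \<le> 1"
    using assms by (auto simp: q_def)
  define T where "T j \<omega> = norm (complex_of_real (X j \<omega>) + \<alpha>) powr (2 / 3)" for j \<omega>
  define U where "U j \<omega> = T j \<omega> powr q" for j \<omega>
  have T_pos: "T j \<omega> > 0" for j \<omega>
    using denominator_nonzero by (simp add: T_def)
  have meas [measurable]: "T j \<in> borel_measurable M" "U j \<in> borel_measurable M" if "j \<ge> 1" for j
    using that unfolding U_def[abs_def] T_def[abs_def] by measurable
  have T: "integrable M (T j)" "expectation (T j) = \<tau>" if "j \<ge> 1" for j
    using integrable_X_iff[OF that, of "\<lambda>x. norm (complex_of_real x + \<alpha>) powr (2 / 3)"]
      expectation_X[OF that, of "\<lambda>x. norm (complex_of_real x + \<alpha>) powr (2 / 3)"]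
      integrable_cauchy_powr[OF \<sigma>_pos, of "2 / 3" \<mu> \<alpha>]
    by (auto simp: T_def[abs_def] \<tau>_def)
  have U_le: "U j \<omega> \<le> 1 + q * (T j \<omega> - 1)" for j \<omega>
    unfolding U_def by (rule powr_le_affine[OF T_pos q])
  have int_U: "integrable M (U j)" if "j \<ge> 1" for j
  proof (rule Bochner_Integration.integrable_bound)
    show "integrable M (\<lambda>\<omega>. 1 + q * (T j \<omega> - 1))"
      using T(1)[OF that] by simp
    show "AE \<omega> in M. norm (U j \<omega>) \<le> norm (1 + q * (T j \<omega> - 1))"
      using U_le[of j] by (auto simp: U_def intro: order.trans[OF _ abs_ge_self])
  qed (use that in measurable)
  have E_U: "expectation (U j) \<le> exp (q * (\<tau> - 1))" if "j \<ge> 1" for j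
  proof -
    have "expectation (U j) \<le> expectation (\<lambda>\<omega>. 1 + q * (T j \<omega> - 1))"
      using T(1)[OF that] by (intro integral_mono int_U that U_le) auto
    also have "\<dots> = 1 + q * (\<tau> - 1)"
      using T[OF that] by (simp add: prob_space)
    also have "\<dots> \<le> exp (q * (\<tau> - 1))"
      by (rule exp_ge_add_one_self)
    finally show ?thesis .
  qed
  have "indep_vars (\<lambda>_. borel) U {1..}"
    unfolding U_def[abs_def] T_def[abs_def] by (rule indep_vars_compose2[OF indep_X]) measurable
  then have indep: "indep_vars (\<lambda>_. borel) U {1..n}"
    by (rule indep_vars_subset) auto
  have int_prod: "integrable M (\<lambda>\<omega>. \<Prod>j=1..n. U j \<omega>)"
    by (rule indep_vars_integrable) (use indep int_U in auto)
  have "expectation (\<lambda>\<omega>. \<Prod>j=1..n. U j \<omega>) = (\<Prod>j=1..n. expectation (U j))"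
    by (rule indep_vars_lebesgue_integral) (use indep int_U in auto)
  also have "\<dots> \<le> (\<Prod>j=1..n. exp (q * (\<tau> - 1)))"
    by (rule prod_mono) (use E_U in \<open>auto simp: U_def intro!: integral_nonneg_AE\<close>)
  also have "\<dots> = exp (3 * p * (\<tau> - 1))"
    using assms by (simp add: q_def flip: exp_of_nat_mult)
  finally have E_prod: "expectation (\<lambda>\<omega>. \<Prod>j=1..n. U j \<omega>) \<le> exp (3 * p * (\<tau> - 1))" .
  have le: "norm (1 / avg n \<omega>) powr p \<le> Im \<alpha> powr - p * (\<Prod>j=1..n. U j \<omega>)" for \<omega>
  proof -
    let ?G = "(\<Prod>j=1..n. (norm (Y j \<omega>))\<^sup>2) powr (1 / real n)"
    have G: "?G > 0"
      using Y_nonzero by (simp add: prod_zero_iff)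
    have "norm (1 / avg n \<omega>) powr p = norm (avg n \<omega>) powr - p"
      by (simp add: norm_divide powr_divide powr_minus_divide)
    also have "\<dots> \<le> (Im \<alpha> * ?G) powr - p"
      using avg_lower_bound[OF assms(2)] G Im_\<alpha> assms(1) by (intro powr_mono2') auto
    also have "\<dots> = Im \<alpha> powr - p * ?G powr - p"
      by (rule powr_mult)
    also have "?G powr - p = (\<Prod>j=1..n. ((norm (Y j \<omega>))\<^sup>2) powr (- p / real n))"
      by (simp add: powr_powr prod_powr_distrib)
    also have "\<dots> = (\<Prod>j=1..n. U j \<omega>)"
    proof (rule prod.cong)
      fix j
      have "(norm (Y j \<omega>))\<^sup>2 = norm (complex_of_real (X j \<omega>) + \<alpha>) powr - 2"
        by (simp add: Y_def norm_divide power_divide powr_minus_divide)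
      then show "((norm (Y j \<omega>))\<^sup>2) powr (- p / real n) = U j \<omega>"
        by (simp add: U_def T_def powr_powr q_def)
    qed simp
    finally show ?thesis .
  qed
  have int: "integrable M (\<lambda>\<omega>. norm (1 / avg n \<omega>) powr p)"
  proof (rule Bochner_Integration.integrable_bound)
    show "integrable M (\<lambda>\<omega>. Im \<alpha> powr - p * (\<Prod>j=1..n. U j \<omega>))"
      using int_prod by simp
    show "AE \<omega> in M. norm (norm (1 / avg n \<omega>) powr p) \<le> norm (Im \<alpha> powr - p * (\<Prod>j=1..n. U j \<omega>))"
      using le by (auto intro: order.trans[OF _ abs_ge_self])
  qed measurable
  have "expectation (\<lambda>\<omega>. norm (1 / avg n \<omega>) powr p)
      \<le> expectation (\<lambda>\<omega>. Im \<alpha> powr - p * (\<Prod>j=1..n. U j \<omega>))"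
    using int_prod by (intro integral_mono int le) auto
  also have "\<dots> \<le> inverse_moment_bound p"
    using E_prod by (simp add: inverse_moment_bound_def mult_left_mono)
  finally show ?thesis
    using int by simp
qed

section \<open>The mean of the reciprocal\<close>

text \<open>The sample points \<open>Y j\<close> are replaced by their mean \<open>m\<close> one at a time.\<close>

lemma expectation_inverse_avg:
  assumes "n \<ge> 3"
  shows "integrable M (\<lambda>\<omega>. 1 / avg n \<omega>) \<and> expectation (\<lambda>\<omega>. 1 / avg n \<omega>) = \<beta>"
proof -
  \<comment> \<open>The first k points have been replaced by \<open>m\<close>: thus V 0 is n times
    \<open>avg n\<close>, and V n is the constant n \<open>m\<close>.\<close>
  define V where "V k \<omega> = of_nat k * m + (\<Sum>j\<in>{Suc k..n}. Y j \<omega>)" for k \<omega>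
  have avg: "1 / avg n \<omega> = of_nat n * (1 / V 0 \<omega>)" for \<omega>
    by (simp add: avg_def V_def)
  have meas [measurable]: "V k \<in> borel_measurable M" for k
    unfolding V_def[abs_def] by measurable
  have "integrable M (\<lambda>\<omega>. norm (1 / avg n \<omega>))"
    using inverse_avg_moment[of 1 n] assms by simp
  then have int_avg: "integrable M (\<lambda>\<omega>. 1 / avg n \<omega>)"
    by (subst (asm) integrable_norm_iff) auto
  have int: "integrable M (\<lambda>\<omega>. 1 / V k \<omega>)" for k
  proof (cases "k = 0")
    case True
    have "1 / V 0 \<omega> = 1 / of_nat n * (1 / avg n \<omega>)" for \<omega>
      using assms by (simp add: avg)
    then show ?thesis
      using int_avg True by (simp only: integrable_mult_right)
  next
    \<comment> \<open>Once at least one point is replaced, the term k \<open>m\<close> keeps Im (V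
      k) away from 0 and the reciprocal is bounded. Only k = 0 relies on the moment
      estimate.\<close>
    case False
    have pos: "0 < - (real k * Im m)"
      using False Im_m_neg by (simp add: mult_pos_neg)
    have "norm (1 / V k \<omega>) \<le> 1 / - (real k * Im m)" for \<omega>
    proof -
      have "- (real k * Im m) \<le> - Im (V k \<omega>)"
        by (simp add: V_def Im_sum_Y_nonpos)
      also have "\<dots> \<le> norm (V k \<omega>)"
        using abs_Im_le_cmod[of "V k \<omega>"] by simp
      finally show ?thesis
        using pos by (simp only: norm_divide norm_one) (rule frac_le; simp)
    qed
    then show ?thesis
      by (intro integrable_const_bound[where B = "1 / - (real k * Im m)"]) auto
  qed
  have step: "expectation (\<lambda>\<omega>. 1 / V k \<omega>) = expectation (\<lambda>\<omega>. 1 / V (Suc k) \<omega>)" if "k < n" for k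
  proof -
    let ?S = "\<lambda>\<omega>. \<Sum>j\<in>{Suc (Suc k)..n}. Y j \<omega>"
    let ?f = "\<lambda>(y, s). 1 / (y + (of_nat k * m + s))"
    have "{Suc k..n} = insert (Suc k) {Suc (Suc k)..n}"
      using that by auto
    then have V: "V k \<omega> = Y (Suc k) \<omega> + (of_nat k * m + ?S \<omega>)" for \<omega>
      by (simp add: V_def)
    have indep: "indep_var borel (Y (Suc k)) borel ?S"
      by (rule indep_vars_sum') (auto intro: indep_vars_subset[OF indep_Y])
    have "(LINT \<omega>|M. ?f (Y (Suc k) \<omega>, ?S \<omega>)) = (LINT \<omega>|M. 1 / (m + (of_nat k * m + ?S \<omega>)))"
    proof (rule indep_var_integral_fst[OF indep])
      show "integrable M (\<lambda>\<omega>. ?f (Y (Suc k) \<omega>, ?S \<omega>))"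
        using int[of k] by (simp add: V)
      fix \<omega>
      \<comment> \<open>Strictness comes from the remaining points if k = 0, where the sum is
        nonempty as n \<ge> 3, and from k \<open>m\<close> otherwise.\<close>
      have "Im (of_nat k * m + ?S \<omega>) < 0"
      proof (cases "k = 0")
        case True
        have "(\<Sum>j\<in>{Suc (Suc k)..n}. Im (Y j \<omega>)) < (\<Sum>j\<in>{Suc (Suc k)..n}. 0)"
          by (rule sum_strict_mono) (use True assms Im_Y_neg in auto)
        then show ?thesis
          using True by simp
      next
        case False
        have "real k * Im m < 0"
          using False Im_m_neg by (simp add: mult_pos_neg)
        moreover have "(\<Sum>j\<in>{Suc (Suc k)..n}. Im (Y j \<omega>)) \<le> 0"
          by (rule Im_sum_Y_nonpos)
        ultimately show ?thesis by simp
      qed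
      then show "(LINT \<omega>'|M. ?f (Y (Suc k) \<omega>', ?S \<omega>)) = 1 / (m + (of_nat k * m + ?S \<omega>))"
        using expectation_inverse_Y_plus[of "Suc k"] by simp
    qed (simp add: borel_measurable_continuous_onI case_prod_beta)
    then show ?thesis
      unfolding V by (simp add: V_def algebra_simps)
  qed
  have "k \<le> n \<Longrightarrow> expectation (\<lambda>\<omega>. 1 / V 0 \<omega>) = expectation (\<lambda>\<omega>. 1 / V k \<omega>)" for k
    by (induction k) (auto simp: step)
  from this[of n] have "expectation (\<lambda>\<omega>. 1 / V 0 \<omega>) = 1 / (of_nat n * m)"
    by (simp add: V_def prob_space)
  then have "expectation (\<lambda>\<omega>. 1 / avg n \<omega>) = \<beta>"
    using assms by (simp only: avg integral_mult_right_zero) (simp add: m_def)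
  with int_avg show ?thesis by simp
qed

section \<open>Deviations of the sample mean from \<open>m\<close>\<close>

lemma norm_Y_squared: "(norm (Y j \<omega>))\<^sup>2 = - Im (Y j \<omega>) / Im \<alpha>"
  using Im_\<alpha> by (simp add: Im_Y)

lemma norm_m_squared: "(norm m)\<^sup>2 = 1 / (norm \<beta>)\<^sup>2"
  by (simp add: m_def norm_divide power_divide)

text \<open>The \<open>Y j\<close> lie on a circle through the origin, so \<open>(norm (Y j))\<^sup>2\<close> is linear in \<open>Im (Y j)\<close>.\<close>

lemma variance_Y:
  assumes "j \<ge> 1"
  shows "expectation (\<lambda>\<omega>. (norm (Y j \<omega> - m))\<^sup>2) = \<sigma> / (Im \<alpha> * (norm \<beta>)\<^sup>2)"
proof -
  have eq: "(norm (Y j \<omega> - m))\<^sup>2 = - (1 / Im \<alpha>) * Im (Y j \<omega>)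
      - 2 * Re m * Re (Y j \<omega>) - 2 * Im m * Im (Y j \<omega>) + (norm m)\<^sup>2" for \<omega>
  proof -
    have "(norm (Y j \<omega> - m))\<^sup>2 = (norm (Y j \<omega>))\<^sup>2
      - 2 * Re m * Re (Y j \<omega>) - 2 * Im m * Im (Y j \<omega>) + (norm m)\<^sup>2"
      by (simp only: cmod_power2 minus_complex.simps) (simp add: power2_eq_square algebra_simps)
    then show ?thesis
      by (simp only: norm_Y_squared) simp
  qed
  note int = integrable_Re[OF integrable_Y[OF assms]] integrable_Im[OF integrable_Y[OF assms]]
  have E: "expectation (\<lambda>\<omega>. Re (Y j \<omega>)) = Re m" "expectation (\<lambda>\<omega>. Im (Y j \<omega>)) = Im m"
    using integrable_Y[OF assms] expectation_Y[OF assms] by simp_all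
  have "expectation (\<lambda>\<omega>. (norm (Y j \<omega> - m))\<^sup>2) = - (1 / Im \<alpha>) * Im m
      - 2 * Re m * Re m - 2 * Im m * Im m + (norm m)\<^sup>2"
    unfolding eq
    by (simp only: Bochner_Integration.integral_diff Bochner_Integration.integral_add
        Bochner_Integration.integrable_diff integrable_const integrable_mult_right int E
        integral_mult_right_zero lebesgue_integral_const prob_space scaleR_one)
  also have "\<dots> = - (1 / Im \<alpha>) * Im m - (norm m)\<^sup>2"
    using cmod_power2[of m] by (simp add: power2_eq_square)
  \<comment> \<open>\<open>m\<close> satisfies the circle identity with \<beta> in place of
    \<alpha>. As Im \<beta> = \<sigma> + Im \<alpha>, the factor Im \<beta> / Im \<alpha> - 1 that
    remains is \<sigma> / Im \<alpha>.\<close>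
  also have "Im m = - Im \<beta> * (norm m)\<^sup>2"
    unfolding m_def by (rule Im_inverse_eq)
  also have "- (1 / Im \<alpha>) * (- Im \<beta> * (norm m)\<^sup>2) - (norm m)\<^sup>2 = \<sigma> / (Im \<alpha> * (norm \<beta>)\<^sup>2)"
    unfolding norm_m_squared Im_\<beta> using Im_\<alpha> \<beta>_nonzero by (simp add: field_simps)
  finally show ?thesis .
qed

text \<open>Here 2 / Im \<alpha> bounds the modulus of \<open>Y j - m\<close>. The factor 12 is 2 *
  3 + 2 * 3: the fourth power of a modulus is at most twice the sum of the fourth powers of real and
  imaginary part, and each part has the constant 3.\<close>

definition deviation_bound :: real where
  "deviation_bound = 12 * (2 / Im \<alpha>) ^ 4"

lemma deviation_bound_nonneg: "0 \<le> deviation_bound"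
  by (simp add: deviation_bound_def)

lemma norm_m_le: "norm m \<le> 1 / Im \<alpha>"
proof -
  have "Im \<alpha> \<le> norm \<beta>"
    using abs_Im_le_cmod[of \<beta>] Im_\<beta> \<sigma>_pos by simp
  then show ?thesis
    using Im_\<alpha> by (simp add: m_def norm_divide frac_le)
qed

lemma norm_avg_diff_le: "norm (avg n \<omega> - m) \<le> 2 / Im \<alpha>"
proof -
  have "norm (\<Sum>j=1..n. Y j \<omega>) \<le> real n * (1 / Im \<alpha>)"
    using sum_norm_bound[of "{1..n}" "\<lambda>j. Y j \<omega>" "1 / Im \<alpha>"] norm_Y_le by simp
  \<comment> \<open>The bound includes n = 0, since \<open>avg 0\<close> is 0 by the convention x /
    0 = 0.\<close>
  then have "norm (avg n \<omega>) \<le> 1 / Im \<alpha>"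
    using Im_\<alpha> by (cases "n = 0") (simp_all add: avg_def norm_divide field_simps)
  then show ?thesis
    using norm_triangle_ineq4[of "avg n \<omega>" m] norm_m_le by simp
qed

text \<open>The real and imaginary parts of \<open>Y j - m\<close> each form an independent,
  bounded, centered real family. The two families need not be independent of each other: squared
  moduli add, and the fourth power is split by an inequality.\<close>

lemma avg_deviation:
  assumes "n \<ge> 1"
  shows "expectation (\<lambda>\<omega>. (norm (avg n \<omega> - m))\<^sup>2) = \<sigma> / (Im \<alpha> * (norm \<beta>)\<^sup>2) / real n"
    and "expectation (\<lambda>\<omega>. norm (avg n \<omega> - m) ^ 4) \<le> deviation_bound / (real n)\<^sup>2"
proof -
  let ?c = "2 / Im \<alpha>"
  have bound: "norm (Y j \<omega> - m) \<le> ?c" for j \<omega>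
    using norm_triangle_ineq4[of "Y j \<omega>" m] norm_m_le norm_Y_le[of j \<omega>] by simp
  define R where "R j \<omega> = Re (Y j \<omega> - m)" for j \<omega>
  define I where "I j \<omega> = Im (Y j \<omega> - m)" for j \<omega>
  have [measurable]: "R j \<in> borel_measurable M" "I j \<in> borel_measurable M" if "j \<ge> 1" for j
    using that unfolding R_def[abs_def] I_def[abs_def] by measurable
  have bR: "\<bar>R j \<omega>\<bar> \<le> ?c" for j \<omega>
    unfolding R_def using abs_Re_le_cmod bound by (rule order.trans)
  have bI: "\<bar>I j \<omega>\<bar> \<le> ?c" for j \<omega>
    unfolding I_def using abs_Im_le_cmod bound by (rule order.trans)
  have "indep_vars (\<lambda>_. borel) R {1..}" "indep_vars (\<lambda>_. borel) I {1..}"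
    unfolding R_def[abs_def] I_def[abs_def]
    by (rule indep_vars_compose2[OF indep_Y, where Y = "\<lambda>_ z. Re (z - m)"], measurable)
      (rule indep_vars_compose2[OF indep_Y, where Y = "\<lambda>_ z. Im (z - m)"], measurable)
  then have indep: "indep_vars (\<lambda>_. borel) R {1..n}" "indep_vars (\<lambda>_. borel) I {1..n}"
    by (auto intro: indep_vars_subset)
  have ER: "expectation (R j) = 0" and EI: "expectation (I j) = 0" if "j \<ge> 1" for j
    using integrable_Y[OF that] expectation_Y[OF that] unfolding R_def[abs_def] I_def[abs_def]
    by (simp_all add: prob_space)
  let ?R = "\<lambda>\<omega>. \<Sum>j=1..n. R j \<omega>" and ?I = "\<lambda>\<omega>. \<Sum>j=1..n. I j \<omega>"
  have momR: "expectation (\<lambda>\<omega>. (?R \<omega>)\<^sup>2) = (\<Sum>j=1..n. expectation (\<lambda>\<omega>. (R j \<omega>)\<^sup>2))"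
      "expectation (\<lambda>\<omega>. ?R \<omega> ^ 4) \<le> 3 * ?c ^ 4 * (real n)\<^sup>2"
    using indep_bounded_centered_sum_moments[OF _ indep(1), of ?c] ER bR by auto
  have momI: "expectation (\<lambda>\<omega>. (?I \<omega>)\<^sup>2) = (\<Sum>j=1..n. expectation (\<lambda>\<omega>. (I j \<omega>)\<^sup>2))"
      "expectation (\<lambda>\<omega>. ?I \<omega> ^ 4) \<le> 3 * ?c ^ 4 * (real n)\<^sup>2"
    using indep_bounded_centered_sum_moments[OF _ indep(2), of ?c] EI bI by auto
  have b: "\<bar>?R \<omega>\<bar> \<le> real n * ?c" "\<bar>?I \<omega>\<bar> \<le> real n * ?c" for \<omega>
    using sum_norm_bound[of "{1..n}" "\<lambda>j. R j \<omega>" ?c] sum_norm_bound[of "{1..n}" "\<lambda>j. I j \<omega>" ?c] bR bI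
    by simp_all
  have int: "integrable M (\<lambda>\<omega>. ?R \<omega> ^ k)" "integrable M (\<lambda>\<omega>. ?I \<omega> ^ k)" for k
    by (rule integrable_const_bound[where B = "(real n * ?c) ^ k"],
      use b in \<open>auto simp del: sum.cl_ivl_Suc simp: power_abs intro!: power_mono\<close>)+
  have int1: "integrable M (\<lambda>\<omega>. (R j \<omega>)\<^sup>2)" "integrable M (\<lambda>\<omega>. (I j \<omega>)\<^sup>2)" if "j \<ge> 1" for j
    by (rule integrable_const_bound[where B = "?c\<^sup>2"],
      use power_mono[OF bR[of j] abs_ge_zero, of _ 2] power_mono[OF bI[of j] abs_ge_zero, of _ 2] that
      in \<open>auto simp del: power_divide\<close>)+
  have norm2: "(norm (avg n \<omega> - m))\<^sup>2 = ((?R \<omega>)\<^sup>2 + (?I \<omega>)\<^sup>2) / (real n)\<^sup>2" for \<omega>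
  proof -
    have "avg n \<omega> - m = (\<Sum>j=1..n. Y j \<omega> - m) / of_nat n"
      using assms by (simp add: avg_def sum_subtractf diff_divide_distrib)
    then have "(norm (avg n \<omega> - m))\<^sup>2 = (norm (\<Sum>j=1..n. Y j \<omega> - m))\<^sup>2 / (real n)\<^sup>2"
      by (simp add: norm_divide power_divide)
    then show ?thesis
      by (simp only: cmod_power2 Re_sum Im_sum R_def I_def)
  qed
  have "expectation (\<lambda>\<omega>. (norm (avg n \<omega> - m))\<^sup>2)
      = (expectation (\<lambda>\<omega>. (?R \<omega>)\<^sup>2) + expectation (\<lambda>\<omega>. (?I \<omega>)\<^sup>2)) / (real n)\<^sup>2"
    unfolding norm2 by (simp only: integral_divide_zero Bochner_Integration.integral_add int)
  also have "expectation (\<lambda>\<omega>. (?R \<omega>)\<^sup>2) + expectation (\<lambda>\<omega>. (?I \<omega>)\<^sup>2)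
      = (\<Sum>j=1..n. expectation (\<lambda>\<omega>. (norm (Y j \<omega> - m))\<^sup>2))"
    unfolding momR momI sum.distrib[symmetric] using int1
    by (intro sum.cong refl) (simp add: cmod_power2 R_def I_def flip: Bochner_Integration.integral_add)
  also have "\<dots> = real n * (\<sigma> / (Im \<alpha> * (norm \<beta>)\<^sup>2))"
    by (simp add: variance_Y)
  finally show "expectation (\<lambda>\<omega>. (norm (avg n \<omega> - m))\<^sup>2) = \<sigma> / (Im \<alpha> * (norm \<beta>)\<^sup>2) / real n"
    using assms by (simp add: power2_eq_square)
  have le: "norm (avg n \<omega> - m) ^ 4 \<le> (2 * ?R \<omega> ^ 4 + 2 * ?I \<omega> ^ 4) / real n ^ 4" for \<omega>
  proof -
    have "norm (avg n \<omega> - m) ^ 4 = ((norm (avg n \<omega> - m))\<^sup>2)\<^sup>2"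
      by simp
    also have "\<dots> = ((?R \<omega>)\<^sup>2 + (?I \<omega>)\<^sup>2)\<^sup>2 / real n ^ 4"
      unfolding norm2 by (simp add: power_divide)
    also have "((?R \<omega>)\<^sup>2 + (?I \<omega>)\<^sup>2)\<^sup>2 \<le> 2 * ((?R \<omega>)\<^sup>2)\<^sup>2 + 2 * ((?I \<omega>)\<^sup>2)\<^sup>2"
      using sum_squares_bound[of "(?R \<omega>)\<^sup>2" "(?I \<omega>)\<^sup>2"] by (simp only: power2_sum)
    finally show ?thesis
      by (simp add: divide_right_mono)
  qed
  have "expectation (\<lambda>\<omega>. norm (avg n \<omega> - m) ^ 4)
      \<le> expectation (\<lambda>\<omega>. (2 * ?R \<omega> ^ 4 + 2 * ?I \<omega> ^ 4) / real n ^ 4)"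
  proof (intro integral_mono le)
    show "integrable M (\<lambda>\<omega>. norm (avg n \<omega> - m) ^ 4)"
      by (rule integrable_const_bound[where B = "?c ^ 4"])
        (use norm_avg_diff_le in \<open>auto intro!: power_mono\<close>)
    show "integrable M (\<lambda>\<omega>. (2 * ?R \<omega> ^ 4 + 2 * ?I \<omega> ^ 4) / real n ^ 4)"
      by (intro integrable_divide_zero Bochner_Integration.integrable_add integrable_mult_right int)
  qed
  also have "\<dots> = (2 * expectation (\<lambda>\<omega>. ?R \<omega> ^ 4) + 2 * expectation (\<lambda>\<omega>. ?I \<omega> ^ 4)) / real n ^ 4"
    by (simp only: integral_divide_zero Bochner_Integration.integral_add integrable_mult_right
        integral_mult_right_zero int)
  also have "\<dots> \<le> (2 * (3 * ?c ^ 4 * (real n)\<^sup>2) + 2 * (3 * ?c ^ 4 * (real n)\<^sup>2)) / real n ^ 4"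
    by (intro divide_right_mono add_mono mult_left_mono momR momI) auto
  also have "\<dots> = deviation_bound / (real n)\<^sup>2"
    using assms by (simp add: deviation_bound_def power2_eq_square power4_eq_xxxx field_simps)
  finally show "expectation (\<lambda>\<omega>. norm (avg n \<omega> - m) ^ 4) \<le> deviation_bound / (real n)\<^sup>2" .
qed

lemma integrable_avg_deviation: "integrable M (\<lambda>\<omega>. norm (avg n \<omega> - m) ^ k)"
  by (rule integrable_const_bound[where B = "(2 / Im \<alpha>) ^ k"])
    (use norm_avg_diff_le in \<open>auto intro!: power_mono\<close>)

text \<open>Strong law via fourth moments: these are summable, so almost surely the series of fourth
  powers of the deviations is finite and its terms tend to 0.\<close>

lemma AE_avg_tendsto: "AE \<omega> in M. (\<lambda>n. avg n \<omega>) \<longlonglongrightarrow> m"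
proof -
  \<comment> \<open>The index shift avoids n = 0, where the bound of order 1 / n^2 is
    meaningless.\<close>
  define d where "d n \<omega> = norm (avg (Suc n) \<omega> - m) ^ 4" for n \<omega>
  have [measurable]: "d n \<in> borel_measurable M" for n
    unfolding d_def[abs_def] by measurable
  have summable: "summable (\<lambda>n. deviation_bound * (1 / (real (Suc n))\<^sup>2))"
    using summable_Suc_iff[of "\<lambda>n. 1 / (real n)\<^sup>2"] inverse_power_summable[of 2, where 'a = real]
    by (intro summable_mult) (simp add: divide_inverse power_inverse)
  have "(\<integral>\<^sup>+\<omega>. (\<Sum>n. ennreal (d n \<omega>)) \<partial>M) = (\<Sum>n. \<integral>\<^sup>+\<omega>. ennreal (d n \<omega>) \<partial>M)"
    by (rule nn_integral_suminf) measurable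
  also have "\<dots> \<le> (\<Sum>n. ennreal (deviation_bound * (1 / (real (Suc n))\<^sup>2)))"
  proof (rule suminf_le)
    fix n
    have "(\<integral>\<^sup>+\<omega>. ennreal (d n \<omega>) \<partial>M) = ennreal (expectation (d n))"
      by (rule nn_integral_eq_integral) (auto simp: d_def[abs_def] integrable_avg_deviation)
    also have "\<dots> \<le> ennreal (deviation_bound * (1 / (real (Suc n))\<^sup>2))"
      using avg_deviation(2)[of "Suc n"] by (intro ennreal_leI) (simp add: d_def[abs_def])
    finally show "(\<integral>\<^sup>+\<omega>. ennreal (d n \<omega>) \<partial>M) \<le> ennreal (deviation_bound * (1 / (real (Suc n))\<^sup>2))" .
  qed auto
  also have "\<dots> = ennreal (\<Sum>n. deviation_bound * (1 / (real (Suc n))\<^sup>2))"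
    using summable deviation_bound_nonneg by (intro suminf_ennreal2) auto
  finally have "(\<integral>\<^sup>+\<omega>. (\<Sum>n. ennreal (d n \<omega>)) \<partial>M) \<noteq> \<infinity>"
    by (auto simp: top_unique)
  then have "AE \<omega> in M. (\<Sum>n. ennreal (d n \<omega>)) \<noteq> \<infinity>"
    by (intro nn_integral_PInf_AE) measurable
  then show ?thesis
  proof eventually_elim
    case (elim \<omega>)
    then have "summable (\<lambda>n. d n \<omega>)"
      by (intro summable_suminf_not_top) (auto simp: d_def)
    then have "(\<lambda>n. root 4 (d n \<omega>)) \<longlonglongrightarrow> root 4 0"
      by (intro tendsto_real_root summable_LIMSEQ_zero)
    then have "(\<lambda>n. norm (avg (Suc n) \<omega> - m)) \<longlonglongrightarrow> 0"
      by (simp add: d_def real_root_power_cancel)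
    then have "(\<lambda>n. avg (Suc n) \<omega>) \<longlonglongrightarrow> m"
      by (simp add: tendsto_norm_zero_iff LIM_zero_iff)
    then show ?case
      by (rule LIMSEQ_imp_Suc)
  qed
qed

lemma AE_inverse_avg_tendsto: "AE \<omega> in M. (\<lambda>n. 1 / avg n \<omega>) \<longlonglongrightarrow> \<beta>"
  using AE_avg_tendsto
proof eventually_elim
  case (elim \<omega>)
  from tendsto_divide[OF tendsto_const[of 1] this m_nonzero] show ?case
    by (simp add: m_def)
qed

section \<open>Convergence of the reciprocal in \<open>L\<^sup>p\<close> and its asymptotic
  variance\<close>

lemma deviation_moment:
  assumes "q > 0" "n \<ge> 1" "3 * q \<le> real n"
  shows "integrable M (\<lambda>\<omega>. norm (1 / avg n \<omega> - \<beta>) powr q)"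
    and "expectation (\<lambda>\<omega>. norm (1 / avg n \<omega> - \<beta>) powr q)
      \<le> 2 powr q * (inverse_moment_bound q + norm \<beta> powr q)"
proof -
  note mom = inverse_avg_moment[OF assms]
  have le: "norm (1 / avg n \<omega> - \<beta>) powr q \<le> 2 powr q * (norm (1 / avg n \<omega>) powr q + norm \<beta> powr q)" for \<omega>
  proof -
    have "norm (1 / avg n \<omega> - \<beta>) powr q \<le> (norm (1 / avg n \<omega>) + norm \<beta>) powr q"
      using assms norm_triangle_ineq4 by (intro powr_mono2) auto
    also have "\<dots> \<le> 2 powr q * (norm (1 / avg n \<omega>) powr q + norm \<beta> powr q)"
      using assms by (intro powr_add_le) auto
    finally show ?thesis .
  qed
  have int: "integrable M (\<lambda>\<omega>. 2 powr q * (norm (1 / avg n \<omega>) powr q + norm \<beta> powr q))"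
    using mom by (intro integrable_mult_right Bochner_Integration.integrable_add) auto
  show int': "integrable M (\<lambda>\<omega>. norm (1 / avg n \<omega> - \<beta>) powr q)"
  proof (rule Bochner_Integration.integrable_bound[OF int])
    show "AE \<omega> in M. norm (norm (1 / avg n \<omega> - \<beta>) powr q)
        \<le> norm (2 powr q * (norm (1 / avg n \<omega>) powr q + norm \<beta> powr q))"
      by (rule AE_I2) (use le in \<open>auto intro: order.trans[OF _ abs_ge_self]\<close>)
  qed measurable
  have "expectation (\<lambda>\<omega>. norm (1 / avg n \<omega> - \<beta>) powr q)
      \<le> expectation (\<lambda>\<omega>. 2 powr q * (norm (1 / avg n \<omega>) powr q + norm \<beta> powr q))"
    by (rule integral_mono[OF int' int le])
  also have "\<dots> = 2 powr q * (expectation (\<lambda>\<omega>. norm (1 / avg n \<omega>) powr q) + norm \<beta> powr q)"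
    using mom by (simp only: integral_mult_right_zero Bochner_Integration.integral_add
        integrable_const lebesgue_integral_const prob_space scaleR_one)
  also have "\<dots> \<le> 2 powr q * (inverse_moment_bound q + norm \<beta> powr q)"
    using mom by (intro mult_left_mono) auto
  finally show "expectation (\<lambda>\<omega>. norm (1 / avg n \<omega> - \<beta>) powr q)
      \<le> 2 powr q * (inverse_moment_bound q + norm \<beta> powr q)" .
qed

lemma eventually_sample_size:
  assumes "q > 0"
  shows "\<forall>\<^sub>F n in sequentially. n \<ge> 1 \<and> 3 * q \<le> real n"
  using eventually_ge_at_top[of 1] eventually_ge_at_top[of "nat \<lceil>3 * q\<rceil>"]
  by eventually_elim linarith

text \<open>Almost sure convergence passes to p-th means because the squares, that is the moments of
  order 2 p, are bounded for large n.\<close>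

lemma deviation_Lp:
  assumes "p > 0"
  shows "(\<lambda>n. expectation (\<lambda>\<omega>. norm (1 / avg n \<omega> - \<beta>) powr p)) \<longlonglongrightarrow> 0"
proof (rule tendsto_expectation_0)
  show "AE \<omega> in M. (\<lambda>n. norm (1 / avg n \<omega> - \<beta>) powr p) \<longlonglongrightarrow> 0"
    using AE_inverse_avg_tendsto
  proof eventually_elim
    case (elim \<omega>)
    then have "(\<lambda>n. norm (1 / avg n \<omega> - \<beta>)) \<longlonglongrightarrow> 0"
      by (simp add: tendsto_norm_zero_iff LIM_zero_iff)
    then show ?case
      using assms by (intro tendsto_zero_powrI[OF _ tendsto_const]) auto
  qed
  have sq: "(norm (1 / avg n \<omega> - \<beta>) powr p)\<^sup>2 = norm (1 / avg n \<omega> - \<beta>) powr (2 * p)" for n \<omega>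
    by (simp add: power2_eq_square flip: powr_add)
  show "\<forall>\<^sub>F n in sequentially. integrable M (\<lambda>\<omega>. (norm (1 / avg n \<omega> - \<beta>) powr p)\<^sup>2) \<and>
      expectation (\<lambda>\<omega>. (norm (1 / avg n \<omega> - \<beta>) powr p)\<^sup>2)
        \<le> 2 powr (2 * p) * (inverse_moment_bound (2 * p) + norm \<beta> powr (2 * p))"
    using eventually_sample_size[of "2 * p"] assms
    unfolding sq by (auto elim!: eventually_mono intro!: deviation_moment)
qed auto

text \<open>With f = n \<bar>avg - m\<bar>^2 and \<bar>1 / avg\<bar>^2 = \<bar>\<beta>\<bar>^2 + g,
  the scaled squared deviation is \<bar>\<beta>\<bar>^4 f + \<bar>\<beta>\<bar>^2 f g. The first
  term has exactly the limit as its mean. The mean of f g tends to 0, since f is bounded and g tends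
  to 0 in mean square.\<close>

lemma deviation_variance:
  "(\<lambda>n. real n * expectation (\<lambda>\<omega>. (norm (1 / avg n \<omega> - \<beta>))\<^sup>2)) \<longlonglongrightarrow> \<sigma> / Im \<alpha> * (norm \<beta>)\<^sup>2"
proof -
  define f where "f n \<omega> = real n * (norm (avg n \<omega> - m))\<^sup>2" for n \<omega>
  define g where "g n \<omega> = (norm (1 / avg n \<omega>))\<^sup>2 - (norm \<beta>)\<^sup>2" for n \<omega>
  have [measurable]: "f n \<in> borel_measurable M" "g n \<in> borel_measurable M" for n
    unfolding f_def[abs_def] g_def[abs_def] by measurable
  have f2: "integrable M (\<lambda>\<omega>. (f n \<omega>)\<^sup>2) \<and> expectation (\<lambda>\<omega>. (f n \<omega>)\<^sup>2) \<le> deviation_bound"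
    if "n \<ge> 1" for n
  proof -
    have eq: "(f n \<omega>)\<^sup>2 = (real n)\<^sup>2 * norm (avg n \<omega> - m) ^ 4" for \<omega>
      by (simp add: f_def power_mult_distrib)
    have "(real n)\<^sup>2 * expectation (\<lambda>\<omega>. norm (avg n \<omega> - m) ^ 4) \<le> deviation_bound"
      using avg_deviation(2)[OF that] that by (simp add: field_simps)
    then show ?thesis
      unfolding eq using integrable_avg_deviation[of n 4] by simp
  qed
  \<comment> \<open>The square of g is controlled through its own second moment, hence through the
    eighth moment of \<open>1 / avg n\<close>; this takes n \<ge> 3 * 8 = 24.\<close>
  have g4: "integrable M (\<lambda>\<omega>. ((g n \<omega>)\<^sup>2)\<^sup>2) \<and>
      expectation (\<lambda>\<omega>. ((g n \<omega>)\<^sup>2)\<^sup>2) \<le> inverse_moment_bound 8 + norm \<beta> ^ 8" if "n \<ge> 24" for n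
  proof -
    have mom: "integrable M (\<lambda>\<omega>. norm (1 / avg n \<omega>) ^ 8)"
        "expectation (\<lambda>\<omega>. norm (1 / avg n \<omega>) ^ 8) \<le> inverse_moment_bound 8"
      using inverse_avg_moment[of 8 n] that by (simp_all del: norm_divide)
    have le: "((g n \<omega>)\<^sup>2)\<^sup>2 \<le> norm (1 / avg n \<omega>) ^ 8 + norm \<beta> ^ 8" for \<omega>
    proof -
      have "\<bar>x - y\<bar> ^ 4 \<le> x ^ 4 + y ^ 4" if "0 \<le> x" "0 \<le> y" for x y :: real
      proof (cases "x \<le> y")
        case True
        then have "\<bar>x - y\<bar> ^ 4 \<le> y ^ 4"
          using that by (intro power_mono) auto
        then show ?thesis by (simp add: add_increasing)
      next
        case False
        then have "\<bar>x - y\<bar> ^ 4 \<le> x ^ 4"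
          using that by (intro power_mono) auto
        then show ?thesis by (simp add: add_increasing2)
      qed
      from this[of "(norm (1 / avg n \<omega>))\<^sup>2" "(norm \<beta>)\<^sup>2"] show ?thesis
        unfolding g_def by (simp add: power_even_abs flip: power_mult del: norm_divide)
    qed
    have int: "integrable M (\<lambda>\<omega>. norm (1 / avg n \<omega>) ^ 8 + norm \<beta> ^ 8)"
      using mom(1) by simp
    have int': "integrable M (\<lambda>\<omega>. ((g n \<omega>)\<^sup>2)\<^sup>2)"
    proof (rule Bochner_Integration.integrable_bound[OF int])
      show "AE \<omega> in M. norm (((g n \<omega>)\<^sup>2)\<^sup>2) \<le> norm (norm (1 / avg n \<omega>) ^ 8 + norm \<beta> ^ 8)"
        by (rule AE_I2) (use le in \<open>auto intro: order.trans[OF _ abs_ge_self]\<close>)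
    qed measurable
    have "expectation (\<lambda>\<omega>. ((g n \<omega>)\<^sup>2)\<^sup>2) \<le> expectation (\<lambda>\<omega>. norm (1 / avg n \<omega>) ^ 8 + norm \<beta> ^ 8)"
      by (rule integral_mono[OF int' int le])
    also have "\<dots> = expectation (\<lambda>\<omega>. norm (1 / avg n \<omega>) ^ 8) + norm \<beta> ^ 8"
      using mom(1) by (simp only: Bochner_Integration.integral_add integrable_const
          lebesgue_integral_const prob_space scaleR_one)
    finally show ?thesis
      using mom(2) int' by simp
  qed
  have "(\<lambda>n. expectation (\<lambda>\<omega>. (g n \<omega>)\<^sup>2)) \<longlonglongrightarrow> 0"
  proof (rule tendsto_expectation_0)
    show "AE \<omega> in M. (\<lambda>n. (g n \<omega>)\<^sup>2) \<longlonglongrightarrow> 0"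
      using AE_inverse_avg_tendsto
    proof eventually_elim
      case (elim \<omega>)
      then have "(\<lambda>n. g n \<omega>) \<longlonglongrightarrow> (norm \<beta>)\<^sup>2 - (norm \<beta>)\<^sup>2"
        unfolding g_def by (intro tendsto_intros)
      from tendsto_power[OF this, of 2] show ?case by simp
    qed
    show "\<forall>\<^sub>F n in sequentially. integrable M (\<lambda>\<omega>. ((g n \<omega>)\<^sup>2)\<^sup>2) \<and>
        expectation (\<lambda>\<omega>. ((g n \<omega>)\<^sup>2)\<^sup>2) \<le> inverse_moment_bound 8 + norm \<beta> ^ 8"
      using eventually_ge_at_top[of 24] by eventually_elim (rule g4)
  qed auto
  moreover have g2: "integrable M (\<lambda>\<omega>. (g n \<omega>)\<^sup>2)" if "n \<ge> 24" for n
    by (rule square_integrable_imp_integrable) (use g4[OF that] in auto)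
  moreover have "\<forall>\<^sub>F n in sequentially. integrable M (\<lambda>\<omega>. (f n \<omega>)\<^sup>2) \<and>
      expectation (\<lambda>\<omega>. (f n \<omega>)\<^sup>2) \<le> deviation_bound"
    using eventually_ge_at_top[of 1] by eventually_elim (rule f2)
  moreover have "\<forall>\<^sub>F n in sequentially. integrable M (\<lambda>\<omega>. (g n \<omega>)\<^sup>2)"
    using eventually_ge_at_top[of 24] by eventually_elim (rule g2)
  ultimately have fg: "(\<lambda>n. expectation (\<lambda>\<omega>. f n \<omega> * g n \<omega>)) \<longlonglongrightarrow> 0"
    by (intro tendsto_integral_mult_0[where K = deviation_bound]) auto
  have "real n * expectation (\<lambda>\<omega>. (norm (1 / avg n \<omega> - \<beta>))\<^sup>2)
      = (norm \<beta>)\<^sup>2 * expectation (\<lambda>\<omega>. f n \<omega> * g n \<omega>) + \<sigma> / Im \<alpha> * (norm \<beta>)\<^sup>2" if "n \<ge> 24" for n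
  proof -
    have n: "n \<ge> 1" using that by simp
    have eq: "real n * (norm (1 / avg n \<omega> - \<beta>))\<^sup>2 = (norm \<beta>)\<^sup>2 * (f n \<omega> * g n \<omega>)
        + real n * norm \<beta> ^ 4 * (norm (avg n \<omega> - m))\<^sup>2" for \<omega>
    proof -
      have "1 / avg n \<omega> - \<beta> = - (\<beta> * (avg n \<omega> - m) * (1 / avg n \<omega>))"
        using avg_nonzero[OF n, of \<omega>] \<beta>_nonzero by (simp add: m_def right_diff_distrib diff_divide_distrib)
      then have "norm (1 / avg n \<omega> - \<beta>) = norm \<beta> * norm (avg n \<omega> - m) * norm (1 / avg n \<omega>)"
        by (simp only: norm_minus_cancel norm_mult)
      then have "(norm (1 / avg n \<omega> - \<beta>))\<^sup>2
          = (norm \<beta>)\<^sup>2 * (norm (avg n \<omega> - m))\<^sup>2 * (g n \<omega> + (norm \<beta>)\<^sup>2)"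
        by (simp add: g_def power_mult_distrib del: norm_divide)
      then have "real n * (norm (1 / avg n \<omega> - \<beta>))\<^sup>2
          = (norm \<beta>)\<^sup>2 * (f n \<omega> * (g n \<omega> + (norm \<beta>)\<^sup>2))"
        by (simp only: f_def mult_ac)
      also have "\<dots> = (norm \<beta>)\<^sup>2 * (f n \<omega> * g n \<omega>) + (norm \<beta>)\<^sup>2 * (norm \<beta>)\<^sup>2 * f n \<omega>"
        by (simp only: distrib_left mult_ac)
      also have "(norm \<beta>)\<^sup>2 * (norm \<beta>)\<^sup>2 * f n \<omega> = real n * norm \<beta> ^ 4 * (norm (avg n \<omega> - m))\<^sup>2"
        by (simp add: f_def flip: power_add)
      finally show ?thesis .
    qed
    have fg_int: "integrable M (\<lambda>\<omega>. f n \<omega> * g n \<omega>)"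
    proof (rule Bochner_Integration.integrable_bound)
      show "integrable M (\<lambda>\<omega>. (f n \<omega>)\<^sup>2 + (g n \<omega>)\<^sup>2)"
        using f2[OF n] g2[OF that] by simp
      have "\<bar>x * y\<bar> \<le> x\<^sup>2 + y\<^sup>2" for x y :: real
        using sum_squares_bound[of "\<bar>x\<bar>" "\<bar>y\<bar>"] abs_ge_zero[of "x * y"] unfolding abs_mult power2_abs by linarith
      then show "AE \<omega> in M. norm (f n \<omega> * g n \<omega>) \<le> norm ((f n \<omega>)\<^sup>2 + (g n \<omega>)\<^sup>2)"
        by simp
    qed measurable
    have "real n * expectation (\<lambda>\<omega>. (norm (1 / avg n \<omega> - \<beta>))\<^sup>2)
        = expectation (\<lambda>\<omega>. real n * (norm (1 / avg n \<omega> - \<beta>))\<^sup>2)"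
      by (rule integral_mult_right_zero[symmetric])
    also have "\<dots> = (norm \<beta>)\<^sup>2 * expectation (\<lambda>\<omega>. f n \<omega> * g n \<omega>)
        + real n * norm \<beta> ^ 4 * (\<sigma> / (Im \<alpha> * (norm \<beta>)\<^sup>2) / real n)"
      unfolding eq by (simp only: Bochner_Integration.integral_add integrable_mult_right
          integral_mult_right_zero integrable_avg_deviation fg_int avg_deviation(1)[OF n])
    also have "real n * norm \<beta> ^ 4 * (\<sigma> / (Im \<alpha> * (norm \<beta>)\<^sup>2) / real n) = \<sigma> / Im \<alpha> * (norm \<beta>)\<^sup>2"
      using n \<beta>_nonzero by (simp add: power2_eq_square power4_eq_xxxx)
    finally show ?thesis .
  qed
  then have "\<forall>\<^sub>F n in sequentially. (norm \<beta>)\<^sup>2 * expectation (\<lambda>\<omega>. f n \<omega> * g n \<omega>)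
      + \<sigma> / Im \<alpha> * (norm \<beta>)\<^sup>2 = real n * expectation (\<lambda>\<omega>. (norm (1 / avg n \<omega> - \<beta>))\<^sup>2)"
    by (intro eventually_mono[OF eventually_ge_at_top[of 24]]) simp
  moreover have "(\<lambda>n. (norm \<beta>)\<^sup>2 * expectation (\<lambda>\<omega>. f n \<omega> * g n \<omega>) + \<sigma> / Im \<alpha> * (norm \<beta>)\<^sup>2)
      \<longlonglongrightarrow> (norm \<beta>)\<^sup>2 * 0 + \<sigma> / Im \<alpha> * (norm \<beta>)\<^sup>2"
    by (intro tendsto_intros fg)
  ultimately show ?thesis
    by (simp add: tendsto_cong)
qed

section \<open>Transfer to the estimator\<close>

lemma cauchy_estimator_deviation:
  assumes "n \<ge> 1"
  shows "cauchy_estimator \<alpha> X n \<omega> - \<gamma> = 1 / avg n \<omega> - \<beta>"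
  using cauchy_estimator_eq[OF assms] by (simp add: \<beta>_def)

lemma cauchy_estimator_unbiased:
  assumes "n \<ge> 3"
  shows "integrable M (cauchy_estimator \<alpha> X n)" and "expectation (cauchy_estimator \<alpha> X n) = \<gamma>"
proof -
  have "cauchy_estimator \<alpha> X n = (\<lambda>\<omega>. 1 / avg n \<omega> - \<alpha>)"
    using assms by (intro ext cauchy_estimator_eq) simp
  then show "integrable M (cauchy_estimator \<alpha> X n)" "expectation (cauchy_estimator \<alpha> X n) = \<gamma>"
    using expectation_inverse_avg[OF assms] by (simp_all add: prob_space \<beta>_def)
qed

lemma AE_cauchy_estimator_tendsto: "AE \<omega> in M. (\<lambda>n. cauchy_estimator \<alpha> X n \<omega>) \<longlonglongrightarrow> \<gamma>"
  using AE_inverse_avg_tendsto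
proof eventually_elim
  case (elim \<omega>)
  from tendsto_diff[OF this tendsto_const[of \<alpha>]] have "(\<lambda>n. 1 / avg n \<omega> - \<alpha>) \<longlonglongrightarrow> \<gamma>"
    by (simp add: \<beta>_def)
  moreover have "\<forall>\<^sub>F n in sequentially. cauchy_estimator \<alpha> X n \<omega> = 1 / avg n \<omega> - \<alpha>"
    using eventually_ge_at_top[of 1] by eventually_elim (rule cauchy_estimator_eq)
  ultimately show ?case
    by (simp add: tendsto_cong)
qed

lemma cauchy_estimator_converges_in_Lp:
  assumes "p > 0"
  shows "converges_in_Lp M p (cauchy_estimator \<alpha> X) \<gamma>"
  unfolding converges_in_Lp_def
proof
  show "\<forall>\<^sub>F n in sequentially. integrable M (\<lambda>\<omega>. norm (cauchy_estimator \<alpha> X n \<omega> - \<gamma>) powr p)"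
    using eventually_sample_size[OF assms]
    by eventually_elim (simp add: cauchy_estimator_deviation deviation_moment assms)
  have "\<forall>\<^sub>F n in sequentially. expectation (\<lambda>\<omega>. norm (1 / avg n \<omega> - \<beta>) powr p)
      = expectation (\<lambda>\<omega>. norm (cauchy_estimator \<alpha> X n \<omega> - \<gamma>) powr p)"
    using eventually_ge_at_top[of 1] by eventually_elim (simp add: cauchy_estimator_deviation)
  then show "(\<lambda>n. expectation (\<lambda>\<omega>. norm (cauchy_estimator \<alpha> X n \<omega> - \<gamma>) powr p)) \<longlonglongrightarrow> 0"
    using deviation_Lp[OF assms] by (rule Lim_transform_eventually[rotated])
qed

text \<open>The threshold 6 = 3 * 2 is the sample size at which \<open>deviation_moment\<close>
  provides second moments.\<close>

lemma finite_complex_variance_cauchy_estimator: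
  assumes "n \<ge> 6"
  shows "finite_complex_variance M (cauchy_estimator \<alpha> X n)"
  using assms cauchy_estimator_unbiased[of n] deviation_moment(1)[of 2 n]
  by (simp add: finite_complex_variance_def cauchy_estimator_deviation)

text \<open>For n \<ge> 3 the estimator is centered at \<gamma>, so its variance is the mean squared
  deviation of \<open>1 / avg n\<close> from \<beta>.\<close>

lemma complex_variance_cauchy_estimator_asymp:
  "(\<lambda>n. real n * complex_variance M (cauchy_estimator \<alpha> X n)) \<longlonglongrightarrow> \<sigma> / Im \<alpha> * (norm (\<gamma> + \<alpha>))\<^sup>2"
proof (rule Lim_transform_eventually)
  show "\<forall>\<^sub>F n in sequentially. real n * expectation (\<lambda>\<omega>. (norm (1 / avg n \<omega> - \<beta>))\<^sup>2)
      = real n * complex_variance M (cauchy_estimator \<alpha> X n)"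
    using eventually_ge_at_top[of 3]
    by eventually_elim (simp add: complex_variance_def cauchy_estimator_unbiased cauchy_estimator_deviation)
qed (use deviation_variance in \<open>simp add: \<beta>_def\<close>)

end

theorem theorem4p4:
  fixes M :: "'a measure" and X :: "nat \<Rightarrow> 'a \<Rightarrow> real"
    and \<mu> \<sigma> :: real and \<alpha> :: complex
  assumes "prob_space M"
    and "\<sigma> > 0"
    and "prob_space.indep_vars M (\<lambda>_. borel) X {1..}"
    and "\<And>i. i \<ge> 1 \<Longrightarrow> distributed M lborel (X i) (\<lambda>x. ennreal (cauchy_density \<mu> \<sigma> x))"
    and "\<alpha> \<in> upper_half_plane"
  shows
    "(\<forall>n\<ge>3. integrable M (cauchy_estimator \<alpha> X n) \<and>
        integral\<^sup>L M (cauchy_estimator \<alpha> X n) = Complex \<mu> \<sigma>) \<and>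
     (AE \<omega> in M. (\<lambda>n. cauchy_estimator \<alpha> X n \<omega>) \<longlonglongrightarrow> Complex \<mu> \<sigma>) \<and>
     (\<forall>p>0. converges_in_Lp M p (cauchy_estimator \<alpha> X) (Complex \<mu> \<sigma>)) \<and>
     (\<forall>\<^sub>F n in sequentially. finite_complex_variance M (cauchy_estimator \<alpha> X n)) \<and>
     (\<lambda>n. real n * complex_variance M (cauchy_estimator \<alpha> X n))
        \<longlonglongrightarrow> \<sigma> / Im \<alpha> * (cmod (Complex \<mu> \<sigma> + \<alpha>))\<^sup>2"
proof -
  interpret prob_space M by fact
  interpret cauchy_sample M X \<mu> \<sigma> \<alpha>
  proof
    show "Im \<alpha> > 0"
      using assms(5) by (auto simp: upper_half_plane_def)
  qed (use assms in auto)
  have "\<forall>\<^sub>F n in sequentially. finite_complex_variance M (cauchy_estimator \<alpha> X n)"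
    using eventually_ge_at_top[of 6] by eventually_elim (rule finite_complex_variance_cauchy_estimator)
  then show ?thesis
    using cauchy_estimator_unbiased AE_cauchy_estimator_tendsto cauchy_estimator_converges_in_Lp
      complex_variance_cauchy_estimator_asymp by blast
qed

end
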